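(* Let $\xi=(\mathcal{E},p,T)$ be a Banach bundle, $S$ a paracompact topological space, $\pi$ a continuous open map of $S$ onto $T$, and $\Phi$ a lower semi-continuous map from $S$ to the family of non-empty closed subsets of $\mathcal{E}$ such that $\Phi(s)$ is a convex subset of the fiber $p^{-1}(\pi(s))$ for every $s\in S$. Then there exists a continuous function $f:S\to\mathcal{E}$ with $p\circ f=\pi$ such that $f(s)\in\Phi(s)$ for every $s\in S$. Moreover, if $s_0\in S$ and $x_0\in\Phi(s_0)$, then $f$ can be chosen so that $f(s_0)=x_0$.
   Context: $\mathbb{K}$ is the real or the complex field. A Banach bundle $\xi=(\mathcal{E},p,T)$ consists of a Hausdorff space $T$ (base space), a topological space $\mathcal{E}$ (bundle space, not assumed Hausdorff), and a continuous open surjection $p:\mathcal{E}\to T$ such that each fiber $\mathcal{E}(t)=p^{-1}(t)$ is a Banach space over $\mathbb{K}$ with origin $0_t$, and: addition $\{(x,y)\in\mathcal{E}\times\mathcal{E}: p(x)=p(y)\}\to\mathcal{E}$ and scalar multiplication $\mathbb{K}\times\mathcal{E}\to\mathcal{E}$ are continuous; $x\mapsto\|x\|$ is upper semi-continuous on $\mathcal{E}$; and if $(x_\iota)$ is a net in $\mathcal{E}$ with $p(x_\iota)\to t$ and $\|x_\iota\|\to 0$, then $x_\iota\to 0_t$. Paracompact spaces are assumed to be Hausdorff. A map $\Phi$ from a topological space $T_1$ to the family of subsets of a topological space $T_2$ is lower semi-continuous if for every non-void open $O\subset T_2$ the set $\{t\in T_1: O\cap\Phi(t)\neq\emptyset\}$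 is open in $T_1$. *)

theory Defs
  imports "HOL-Analysis.Analysis"
begin

text \<open>
  The scalar field is a type of class \<open>real_normed_field\<close>. The types \<open>real\<close> and \<open>complex\<close> are
  instances, and by the Gelfand-Mazur theorem every instance is isometrically isomorphic to one
  of the two; so the class says "the real or the complex field". Real scalars are embedded
  by \<open>of_real\<close>.
\<close>

text \<open>
  The fibres of a bundle vary with the base point, so their vector space and norm structure lives
  on subsets of a type rather than on types.
\<close>

locale banach_space_on =
  fixes V :: "'e set"
    and add :: "'e \<Rightarrow> 'e \<Rightarrow> 'e"
    and smul :: "'k::real_normed_field \<Rightarrow> 'e \<Rightarrow> 'e"
    and zero :: 'e
    and nrm :: "'e \<Rightarrow> real"
  assumes zero_closed: "zero \<in> V"
    and add_closed: "\<lbrakk>x \<in> V; y \<in> V\<rbrakk> \<Longrightarrow> add x y \<in> V"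
    and smul_closed: "x \<in> V \<Longrightarrow> smul c x \<in> V"
    and add_assoc: "\<lbrakk>x \<in> V; y \<in> V; z \<in> V\<rbrakk> \<Longrightarrow> add (add x y) z = add x (add y z)"
    and add_commute: "\<lbrakk>x \<in> V; y \<in> V\<rbrakk> \<Longrightarrow> add x y = add y x"
    and add_zero: "x \<in> V \<Longrightarrow> add x zero = x"
    and add_inverse: "x \<in> V \<Longrightarrow> \<exists>y\<in>V. add x y = zero"
    and smul_add_right: "\<lbrakk>x \<in> V; y \<in> V\<rbrakk> \<Longrightarrow> smul c (add x y) = add (smul c x) (smul c y)"
    and smul_add_left: "x \<in> V \<Longrightarrow> smul (c + d) x = add (smul c x) (smul d x)"
    and smul_smul: "x \<in> V \<Longrightarrow> smul c (smul d x) = smul (c * d) x"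
    and smul_one: "x \<in> V \<Longrightarrow> smul 1 x = x"
    and nrm_nonneg: "x \<in> V \<Longrightarrow> 0 \<le> nrm x"
    and nrm_eq_zero: "x \<in> V \<Longrightarrow> nrm x = 0 \<longleftrightarrow> x = zero"
    and nrm_triangle: "\<lbrakk>x \<in> V; y \<in> V\<rbrakk> \<Longrightarrow> nrm (add x y) \<le> nrm x + nrm y"
    and nrm_smul: "x \<in> V \<Longrightarrow> nrm (smul c x) = norm c * nrm x"
    and complete: "\<lbrakk>\<And>n. u n \<in> V;
          \<And>e. 0 < e \<Longrightarrow> \<exists>N. \<forall>m\<ge>N. \<forall>n\<ge>N. nrm (add (u m) (smul (-1) (u n))) < e\<rbrakk>
        \<Longrightarrow> \<exists>l\<in>V. (\<lambda>n. nrm (add (u n) (smul (-1) l))) \<longlonglongrightarrow> 0"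

definition fiber :: "'e topology \<Rightarrow> ('e \<Rightarrow> 't) \<Rightarrow> 't \<Rightarrow> 'e set" where
  "fiber E p t = {x \<in> topspace E. p x = t}"

text \<open>
  In \<open>zero_limit\<close> nets are replaced by filters on the bundle space: a net corresponds to the filter
  generated by its tails, and every proper filter arises in this way. Lemma \<open>zero_limit_net\<close>
  gives the version for families over an arbitrary index type.
\<close>

locale banach_bundle =
  fixes E :: "'e topology"
    and p :: "'e \<Rightarrow> 't"
    and T :: "'t topology"
    and add :: "'e \<Rightarrow> 'e \<Rightarrow> 'e"
    and smul :: "'k::real_normed_field \<Rightarrow> 'e \<Rightarrow> 'e"
    and zero :: "'t \<Rightarrow> 'e"
    and nrm :: "'e \<Rightarrow> real"
  assumes base_Hausdorff: "Hausdorff_space T"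
    and proj_continuous: "continuous_map E T p"
    and proj_open: "open_map E T p"
    and proj_onto: "p ` topspace E = topspace T"
    and fiber_banach: "t \<in> topspace T \<Longrightarrow> banach_space_on (fiber E p t) add smul (zero t) nrm"
    and add_continuous:
      "continuous_map (subtopology (prod_topology E E) {(x, y). p x = p y}) E (\<lambda>(x, y). add x y)"
    and smul_continuous: "continuous_map (prod_topology euclidean E) E (\<lambda>(c, x). smul c x)"
    and nrm_upper_semicontinuous: "openin E {x \<in> topspace E. nrm x < a}"
    and zero_limit: "\<lbrakk>\<forall>\<^sub>F x in F. x \<in> topspace E; limitin T p t F; (nrm \<longlongrightarrow> 0) F\<rbrakk>
        \<Longrightarrow> limitin E (\<lambda>x. x) (zero t) F"

lemma (in banach_bundle) zero_limit_net:
  assumes "\<forall>\<^sub>F i in F. x i \<in> topspace E" "limitin T (\<lambda>i. p (x i)) t F" "((\<lambda>i. nrm (x i)) \<longlongrightarrow> 0) F"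
  shows "limitin E x (zero t) F"
  using zero_limit[of "filtermap x F" t] assms
  by (simp add: limitin_def eventually_filtermap filterlim_filtermap)

definition bundle_convex ::
  "('e \<Rightarrow> 'e \<Rightarrow> 'e) \<Rightarrow> ('k::real_normed_field \<Rightarrow> 'e \<Rightarrow> 'e) \<Rightarrow> 'e set \<Rightarrow> bool" where
  "bundle_convex add smul C \<longleftrightarrow>
    (\<forall>x\<in>C. \<forall>y\<in>C. \<forall>u v :: real. 0 \<le> u \<longrightarrow> 0 \<le> v \<longrightarrow> u + v = 1 \<longrightarrow>
      add (smul (of_real u) x) (smul (of_real v) y) \<in> C)"

definition paracompact_space :: "'a topology \<Rightarrow> bool" where
  "paracompact_space X \<longleftrightarrow>
    Hausdorff_space X \<and>
    (\<forall>\<U>. (\<forall>U\<in>\<U>. openin X U) \<and> \<Union>\<U> = topspace X \<longrightarrow>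
      (\<exists>\<V>. (\<forall>V\<in>\<V>. openin X V) \<and> \<Union>\<V> = topspace X \<and>
        (\<forall>V\<in>\<V>. \<exists>U\<in>\<U>. V \<subseteq> U) \<and> locally_finite_in X \<V>))"

definition lower_semicontinuous_map :: "'a topology \<Rightarrow> 'b topology \<Rightarrow> ('a \<Rightarrow> 'b set) \<Rightarrow> bool" where
  "lower_semicontinuous_map X Y \<Phi> \<longleftrightarrow>
    (\<forall>U. openin Y U \<and> U \<noteq> {} \<longrightarrow> openin X {t \<in> topspace X. U \<inter> \<Phi> t \<noteq> {}})"

end

theory Submission
  imports Defs "HOL-Algebra.FiniteProduct"
begin

text \<open>
  The bundle need not come with any continuous local sections, so Michael's argument is run with
  discontinuous maps whose jumps are controlled. Call \<open>f\<close> an \<open>r\<close>-continuous lift of \<open>\<pi>\<close> if near each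
  \<open>s\<close> its values lie within fibre distance \<open>r\<close> of any given neighbourhood of \<open>f s\<close>. Choosing points of
  \<open>\<Phi> s'\<close> arbitrarily inside open sets of small fibre diameter and averaging them with a partition of
  unity on \<open>S\<close> gives \<open>r\<close>-continuous selections for every \<open>r > 0\<close>; doing this around an already
  constructed selection yields a fibrewise uniformly Cauchy sequence of \<open>2\<^sup>-\<^sup>n\<close>-continuous selections,
  whose limit is continuous because \<open>0\<close>-neighbourhoods in the bundle contain tubes around the zero
  section. The value at \<open>s\<^sub>0\<close> is prescribed by replacing \<open>\<Phi> s\<^sub>0\<close> by \<open>{x\<^sub>0}\<close>, which keeps \<open>\<Phi>\<close> lower
  semicontinuous.
\<close>

no_notation eq_closure_of (\<open>closure'_of\<index>\<close>)

section \<open>Paracompact spaces\<close>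

lemma paracompact_refinement:
  assumes "paracompact_space X" "\<And>U. U \<in> \<U> \<Longrightarrow> openin X U" "\<Union>\<U> = topspace X"
  obtains \<V> where "\<And>V. V \<in> \<V> \<Longrightarrow> openin X V" "\<Union>\<V> = topspace X"
    "\<And>V. V \<in> \<V> \<Longrightarrow> \<exists>U\<in>\<U>. V \<subseteq> U" "locally_finite_in X \<V>"
proof -
  have "(\<forall>U\<in>\<U>. openin X U) \<and> \<Union>\<U> = topspace X" using assms(2,3) by simp
  from assms(1)[unfolded paracompact_space_def, THEN conjunct2, THEN spec, THEN mp, OF this]
  obtain \<V> where "\<forall>V\<in>\<V>. openin X V" "\<Union>\<V> = topspace X" "\<forall>V\<in>\<V>. \<exists>U\<in>\<U>. V \<subseteq> U"
    "locally_finite_in X \<V>"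
    by (elim exE conjE)
  then show thesis by (intro that[of \<V>]) simp_all
qed

text \<open>Closure commutes with locally finite unions, so separation from \<open>D\<close> point
  by point along \<open>C\<close> yields a single neighbourhood of \<open>C\<close>. Taking
  \<open>D\<close> to be a point promotes Hausdorff to regular; taking \<open>D\<close> closed
  promotes regular to normal.\<close>

lemma paracompact_separation:
  assumes X: "paracompact_space X" and C: "closedin X C"
    and sep: "\<And>c. c \<in> C \<Longrightarrow> \<exists>U. openin X U \<and> c \<in> U \<and> disjnt D (X closure_of U)"
  shows "\<exists>V. openin X V \<and> C \<subseteq> V \<and> disjnt D (X closure_of V)"
proof -
  \<comment> \<open>Sets disjoint from \<open>C\<close> only complete the cover. A refining set that
    meets \<open>C\<close> cannot lie in one of them, so it lies in an open set whose closure misses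
    \<open>D\<close>.\<close>
  define \<U> where "\<U> = {U. openin X U \<and> (disjnt D (X closure_of U) \<or> disjnt C U)}"
  have "topspace X - C \<in> \<U>"
    using C by (auto simp: \<U>_def disjnt_def)
  moreover have "C \<subseteq> \<Union>\<U>"
    using sep by (fastforce simp: \<U>_def)
  moreover have "\<Union>\<U> \<subseteq> topspace X"
    using openin_subset by (auto simp: \<U>_def)
  ultimately have "\<Union>\<U> = topspace X" by blast
  then obtain \<V> where \<V>: "\<And>V. V \<in> \<V> \<Longrightarrow> openin X V" "\<Union>\<V> = topspace X"
    "\<And>V. V \<in> \<V> \<Longrightarrow> \<exists>U\<in>\<U>. V \<subseteq> U" "locally_finite_in X \<V>"
    by (rule paracompact_refinement[OF X, rotated 1]) (auto simp: \<U>_def)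
  define \<W> where "\<W> = {V \<in> \<V>. \<not> disjnt C V}"
  have lf: "locally_finite_in X \<W>"
    by (rule locally_finite_in_subset[OF \<V>(4)]) (auto simp: \<W>_def)
  have "disjnt D (X closure_of W)" if W: "W \<in> \<W>" for W
  proof -
    obtain U where "U \<in> \<U>" "W \<subseteq> U" using \<V>(3)[of W] W unfolding \<W>_def by blast
    moreover from this have "\<not> disjnt C U" using that by (auto simp: \<W>_def disjnt_def)
    ultimately show ?thesis
      using closure_of_mono[of W U X] by (auto simp: \<U>_def disjnt_def)
  qed
  then have "disjnt D (X closure_of \<Union>\<W>)"
    unfolding closure_of_locally_finite_Union[OF lf] by (auto simp: disjnt_def)
  moreover have "openin X (\<Union>\<W>)" using \<V>(1) by (auto simp: \<W>_def)
  moreover have "C \<subseteq> \<Union>\<W>"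
  proof
    fix c assume "c \<in> C"
    then have "c \<in> topspace X" using C closedin_subset by blast
    then obtain V where "V \<in> \<V>" "c \<in> V" using \<V>(2) by blast
    then show "c \<in> \<Union>\<W>" using \<open>c \<in> C\<close> by (auto simp: \<W>_def disjnt_def)
  qed
  ultimately show ?thesis by blast
qed

text \<open>Hausdorff separation of \<open>a\<close> and \<open>c\<close> keeps \<open>a\<close> out
  of the closure of a neighbourhood of \<open>c\<close>, so \<open>paracompact_separation\<close>
  applies with \<open>D = {a}\<close>.\<close>

lemma paracompact_imp_regular_space:
  assumes X: "paracompact_space X"
  shows "regular_space X"
  unfolding regular_space_def
proof (intro allI impI, elim conjE)
  fix C a assume C: "closedin X C" and a: "a \<in> topspace X - C"
  have "\<exists>U. openin X U \<and> c \<in> U \<and> disjnt {a} (X closure_of U)" if "c \<in> C" for c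
  proof -
    have "c \<in> topspace X" "c \<noteq> a" using that a C closedin_subset by auto
    then obtain U V where UV: "openin X U" "openin X V" "c \<in> U" "a \<in> V" "disjnt U V"
      using X a unfolding paracompact_space_def Hausdorff_space_def by (metis DiffD1)
    then have "V \<inter> X closure_of U = {}"
      using openin_Int_closure_of_eq_empty[OF UV(2), of U] by (simp add: disjnt_def inf_commute)
    with UV show ?thesis by (intro exI[of _ U]) (auto simp: disjnt_def)
  qed
  from paracompact_separation[OF X C this]
  obtain V where "openin X V" "C \<subseteq> V" "disjnt {a} (X closure_of V)" by blast
  then show "\<exists>U V. openin X U \<and> openin X V \<and> a \<in> U \<and> C \<subseteq> V \<and> disjnt U V"
    using a closure_of_subset[OF openin_subset, of X V]
    by (intro exI[of _ "topspace X - X closure_of V"] exI[of _ V]) (auto simp: disjnt_def)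
qed

lemma paracompact_imp_normal_space:
  assumes X: "paracompact_space X"
  shows "normal_space X"
  unfolding normal_space
proof (intro allI impI, elim conjE)
  fix C D assume C: "closedin X C" and D: "closedin X D" and disj: "disjnt C D"
  show "\<exists>U. openin X U \<and> C \<subseteq> U \<and> disjnt D (X closure_of U)"
  proof (rule paracompact_separation[OF X C])
    fix c assume "c \<in> C"
    then have "c \<in> topspace X - D" using C closedin_subset disj by (auto simp: disjnt_def)
    then show "\<exists>U. openin X U \<and> c \<in> U \<and> disjnt D (X closure_of U)"
      using paracompact_imp_regular_space[OF X] D unfolding regular_space by blast
  qed
qed

text \<open>By regularity, the open sets whose closure fits into some member of \<open>\<V>\<close>
  still cover the space. \<open>C V\<close> collects those pieces of a locally finite refinement
  whose closure fits into \<open>V\<close>; local finiteness keeps the closure of their union inside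
  \<open>V\<close>.\<close>

lemma paracompact_shrinking:
  assumes X: "paracompact_space X" and op: "\<And>V. V \<in> \<V> \<Longrightarrow> openin X V" and un: "\<Union>\<V> = topspace X"
  obtains C where "\<And>V. V \<in> \<V> \<Longrightarrow> closedin X (C V)" "\<And>V. V \<in> \<V> \<Longrightarrow> C V \<subseteq> V"
    "(\<Union>V\<in>\<V>. C V) = topspace X"
proof -
  define \<U> where "\<U> = {U. openin X U \<and> (\<exists>V\<in>\<V>. X closure_of U \<subseteq> V)}"
  have "topspace X \<subseteq> \<Union>\<U>"
  proof
    fix x assume x: "x \<in> topspace X"
    then obtain V where V: "V \<in> \<V>" "x \<in> V" using un by blast
    have "closedin X (topspace X - V)" using op V by blast
    then obtain U where U: "openin X U" "x \<in> U" "disjnt (topspace X - V) (X closure_of U)"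
      using paracompact_imp_regular_space[OF X] V(2) x unfolding regular_space by blast
    then have "X closure_of U \<subseteq> V"
      using closure_of_subset_topspace[of X U] by (auto simp: disjnt_def)
    then show "x \<in> \<Union>\<U>" using U V by (auto simp: \<U>_def)
  qed
  then have "\<Union>\<U> = topspace X"
    using openin_subset by (fastforce simp: \<U>_def)
  then obtain \<W> where \<W>: "\<And>W. W \<in> \<W> \<Longrightarrow> openin X W" "\<Union>\<W> = topspace X"
    "\<And>W. W \<in> \<W> \<Longrightarrow> \<exists>U\<in>\<U>. W \<subseteq> U" "locally_finite_in X \<W>"
    by (rule paracompact_refinement[OF X, rotated 1]) (auto simp: \<U>_def)
  define C where "C V = X closure_of \<Union>{W \<in> \<W>. X closure_of W \<subseteq> V}" for V
  have C: "C V = (\<Union>W\<in>{W \<in> \<W>. X closure_of W \<subseteq> V}. X closure_of W)" for V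
    unfolding C_def
    by (rule closure_of_locally_finite_Union) (rule locally_finite_in_subset[OF \<W>(4)], auto)
  show ?thesis
  proof (rule that)
    show "closedin X (C V)" for V by (simp add: C_def)
    show "C V \<subseteq> V" for V by (auto simp: C)
    show "(\<Union>V\<in>\<V>. C V) = topspace X"
    proof
      show "(\<Union>V\<in>\<V>. C V) \<subseteq> topspace X" by (auto simp: C_def closure_of)
      show "topspace X \<subseteq> (\<Union>V\<in>\<V>. C V)"
      proof
        fix x assume "x \<in> topspace X"
        then obtain W where W: "W \<in> \<W>" "x \<in> W" using \<W>(2) by blast
        then obtain U where "U \<in> \<U>" "W \<subseteq> U" using \<W>(3) by blast
        then obtain V where "V \<in> \<V>" "X closure_of W \<subseteq> V"
          using closure_of_mono[of W U X] by (auto simp: \<U>_def)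
        moreover have "x \<in> X closure_of W"
          using W \<W>(1) closure_of_subset[OF openin_subset] by blast
        ultimately show "x \<in> (\<Union>V\<in>\<V>. C V)" using W by (auto simp: C)
      qed
    qed
  qed
qed

text \<open>Near each point all but finitely many \<open>\<phi> V\<close> vanish, and the others belong to sets \<open>V\<close> that
  contain the whole neighbourhood: this is what closed supports inside \<open>V\<close> provide.\<close>

lemma paracompact_partition_of_unity:
  assumes X: "paracompact_space X"
    and cover: "\<forall>x\<in>topspace X. \<exists>U. openin X U \<and> x \<in> U \<and> P U"
    and mono: "\<forall>U V. P U \<longrightarrow> V \<subseteq> U \<longrightarrow> P V"
  shows "\<exists>\<V> (\<phi> :: 'a set \<Rightarrow> 'a \<Rightarrow> real).
    (\<forall>V\<in>\<V>. openin X V \<and> P V \<and> continuous_map X euclideanreal (\<phi> V) \<and> (\<forall>x\<in>topspace X. 0 \<le> \<phi> V x)) \<and>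
    (\<forall>x\<in>topspace X. \<exists>N F. openin X N \<and> x \<in> N \<and> finite F \<and> F \<subseteq> \<V> \<and> N \<subseteq> \<Inter>F \<and>
       (\<forall>y\<in>N. (\<forall>V\<in>\<V>-F. \<phi> V y = 0) \<and> (\<Sum>V\<in>F. \<phi> V y) = 1))"
proof -
  define \<U> where "\<U> = {U. openin X U \<and> P U}"
  have "\<Union>\<U> = topspace X"
    using cover openin_subset by (fastforce simp: \<U>_def)
  then obtain \<V> where \<V>: "\<And>V. V \<in> \<V> \<Longrightarrow> openin X V" "\<Union>\<V> = topspace X"
    "\<And>V. V \<in> \<V> \<Longrightarrow> \<exists>U\<in>\<U>. V \<subseteq> U" "locally_finite_in X \<V>"
    by (rule paracompact_refinement[OF X, rotated 1]) (auto simp: \<U>_def)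
  obtain C where C: "\<And>V. V \<in> \<V> \<Longrightarrow> closedin X (C V)" "\<And>V. V \<in> \<V> \<Longrightarrow> C V \<subseteq> V"
    "(\<Union>V\<in>\<V>. C V) = topspace X"
    using paracompact_shrinking[OF X _ \<V>(2)] \<V>(1) by blast
  have "\<exists>h::'a \<Rightarrow> real. continuous_map X euclideanreal h \<and> (\<forall>x\<in>topspace X - V. h x = 0) \<and>
    (\<forall>x\<in>C V. h x = 1)" if V: "V \<in> \<V>" for V
  proof -
    have "closedin X (topspace X - V)" "disjnt (topspace X - V) (C V)"
      using V \<V>(1) C(2) by (auto simp: disjnt_def)
    then obtain h :: "'a \<Rightarrow> real" where "continuous_map X euclideanreal h"
      "h ` (topspace X - V) \<subseteq> {0}" "h ` C V \<subseteq> {1}"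
      by (rule Urysohn_lemma_alt[OF paracompact_imp_normal_space[OF X] _ C(1)[OF V]])
    then show ?thesis by blast
  qed
  then have "\<forall>V\<in>\<V>. \<exists>h::'a \<Rightarrow> real. continuous_map X euclideanreal h \<and>
    (\<forall>x\<in>topspace X - V. h x = 0) \<and> (\<forall>x\<in>C V. h x = 1)"
    by (rule ballI)
  from bchoice[OF this]
  obtain h :: "'a set \<Rightarrow> 'a \<Rightarrow> real" where
    h: "\<And>V. V \<in> \<V> \<Longrightarrow> continuous_map X euclideanreal (h V)"
    "\<And>V x. V \<in> \<V> \<Longrightarrow> x \<in> topspace X - V \<Longrightarrow> h V x = 0" "\<And>V x. V \<in> \<V> \<Longrightarrow> x \<in> C V \<Longrightarrow> h V x = 1"
    by blast
  \<comment> \<open>Cutting off below \<open>1/2\<close> makes the support of \<open>g V\<close> a closed subset of \<open>V\<close>.\<close>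
  define g where "g V x = max 0 (2 * h V x - 1)" for V x
  have g_cont: "continuous_map X euclideanreal (g V)" if "V \<in> \<V>" for V
    unfolding g_def using h(1)[OF that]
    by (intro continuous_map_real_max continuous_map_diff continuous_map_real_mult_left) auto
  have g_nonneg: "0 \<le> g V x" for V x by (simp add: g_def)
  define good where "good x N F \<longleftrightarrow> openin X N \<and> x \<in> N \<and> finite F \<and> F \<subseteq> \<V> \<and> N \<subseteq> \<Inter>F \<and>
    (\<forall>y\<in>N. \<forall>V\<in>\<V>-F. g V y = 0)" for x N F
  have "\<exists>N F. good x N F" if x: "x \<in> topspace X" for x
  proof -
    obtain N0 where N0: "openin X N0" "x \<in> N0" "finite {V \<in> \<V>. V \<inter> N0 \<noteq> {}}"
      using \<V>(4) x unfolding locally_finite_in_def by blast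
    \<comment> \<open>The finitely many members meeting \<open>N0\<close> are split by whether they
      contain \<open>x\<close>. Those in \<open>F\<close> are intersected with \<open>N0\<close>.
      For those in \<open>F'\<close>, \<open>h V x = 0\<close>, so \<open>h V\<close> stays below
      \<open>1/2\<close> near \<open>x\<close> and the cut-off \<open>g V\<close> vanishes
      there.\<close>
    define F where "F = {V \<in> \<V>. V \<inter> N0 \<noteq> {} \<and> x \<in> V}"
    define F' where "F' = {V \<in> \<V>. V \<inter> N0 \<noteq> {} \<and> x \<notin> V}"
    define M where "M V = {y \<in> topspace X. h V y \<in> {..<1/2}}" for V
    have fin: "finite F" "finite F'"
      using N0(3) by (auto simp: F_def F'_def elim: rev_finite_subset)
    have M: "openin X (M V)" if "V \<in> \<V>" for V
      unfolding M_def by (rule openin_continuous_map_preimage[OF h(1)[OF that]]) auto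
    have "openin X (\<Inter>(insert N0 (F \<union> M ` F')))"
      by (rule openin_Inter) (use fin N0 M \<V>(1) in \<open>auto simp: F_def F'_def\<close>)
    moreover have "x \<in> \<Inter>(insert N0 (F \<union> M ` F'))"
      using N0(2) x h(2) by (auto simp: F_def F'_def M_def)
    moreover have "g V y = 0" if "y \<in> \<Inter>(insert N0 (F \<union> M ` F'))" "V \<in> \<V> - F" for y V
    proof (cases "V \<in> F'")
      case True
      then have "y \<in> M V" using that by blast
      then show ?thesis by (simp add: M_def g_def)
    next
      case False
      then have "V \<inter> N0 = {}" using that by (auto simp: F_def F'_def)
      moreover have "y \<in> topspace X" using that N0(1) openin_subset by blast
      ultimately have "h V y = 0" using that by (intro h(2)) auto
      then show ?thesis by (simp add: g_def)
    qed
    moreover have "F \<subseteq> \<V>" by (auto simp: F_def)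
    ultimately have "good x (\<Inter>(insert N0 (F \<union> M ` F'))) F"
      using fin(1) unfolding good_def by blast
    then show ?thesis by blast
  qed
  then obtain N F where good: "\<And>x. x \<in> topspace X \<Longrightarrow> good x (N x) (F x)" by metis
  then have NF: "\<And>x. x \<in> topspace X \<Longrightarrow> openin X (N x)"
    "\<And>x. x \<in> topspace X \<Longrightarrow> x \<in> N x" "\<And>x. x \<in> topspace X \<Longrightarrow> finite (F x)"
    "\<And>x. x \<in> topspace X \<Longrightarrow> F x \<subseteq> \<V>" "\<And>x. x \<in> topspace X \<Longrightarrow> N x \<subseteq> \<Inter>(F x)"
    "\<And>x y V. x \<in> topspace X \<Longrightarrow> y \<in> N x \<Longrightarrow> V \<in> \<V> - F x \<Longrightarrow> g V y = 0"
    unfolding good_def by blast+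
  \<comment> \<open>Summing over the support avoids any choice of local family. Near
    \<open>x\<close> the sum equals the finite one over \<open>F x\<close>, so continuity follows by
    pasting.\<close>
  define G where "G y = (\<Sum>V | V \<in> \<V> \<and> g V y \<noteq> 0. g V y)" for y
  have G_eq: "G y = (\<Sum>V\<in>F x. g V y)" if "x \<in> topspace X" "y \<in> N x" for x y
    unfolding G_def
    by (rule sum.mono_neutral_left) (use NF(3,4,6)[OF that(1)] that(2) in blast)+
  have G_cont: "continuous_map X euclideanreal G"
  proof (rule pasting_lemma[where I = "topspace X" and T = N and f = "\<lambda>x y. \<Sum>V\<in>F x. g V y"])
    show "continuous_map (subtopology X (N x)) euclideanreal (\<lambda>y. \<Sum>V\<in>F x. g V y)"
      if "x \<in> topspace X" for x
      using NF(3,4)[OF that] g_cont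
      by (intro continuous_map_from_subtopology continuous_map_sum) auto
    show "openin X (N x)" if "x \<in> topspace X" for x by (rule NF(1)[OF that])
    show "(\<Sum>V\<in>F x. g V z) = (\<Sum>V\<in>F y. g V z)"
      if "x \<in> topspace X" "y \<in> topspace X" "z \<in> topspace X \<inter> N x \<inter> N y" for x y z
      using G_eq[of x z] G_eq[of y z] that by simp
    show "\<exists>y. y \<in> topspace X \<and> x \<in> N y \<and> G x = (\<Sum>V\<in>F y. g V x)"
      if "x \<in> topspace X" for x
      using NF(2)[OF that] G_eq[OF that] that by blast
  qed
  have G_pos: "0 < G x" if x: "x \<in> topspace X" for x
  proof -
    obtain V where V: "V \<in> \<V>" "x \<in> C V" using C(3) x by blast
    then have 1: "g V x = 1" using h(3) by (simp add: g_def)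
    then have "V \<in> F x" using NF(6)[OF x NF(2)[OF x]] V by force
    then have "g V x \<le> (\<Sum>V\<in>F x. g V x)"
      by (intro member_le_sum) (auto simp: g_nonneg NF(3)[OF x])
    then show ?thesis using G_eq[OF x NF(2)[OF x]] 1 by simp
  qed
  show ?thesis
  proof (intro exI[of _ \<V>] exI[of _ "\<lambda>V x. g V x / G x"] conjI ballI)
    show "openin X V" if "V \<in> \<V>" for V using that \<V>(1) by blast
    show "P V" if V: "V \<in> \<V>" for V
    proof -
      obtain U where "U \<in> \<U>" "V \<subseteq> U" using V \<V>(3) by blast
      then show ?thesis using mono by (auto simp: \<U>_def)
    qed
    show "continuous_map X euclideanreal (\<lambda>x. g V x / G x)" if "V \<in> \<V>" for V
    proof (rule continuous_map_real_divide[OF g_cont[OF that] G_cont])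
      show "G x \<noteq> 0" if "x \<in> topspace X" for x using G_pos[OF that] by simp
    qed
    show "0 \<le> g V x / G x" if "x \<in> topspace X" for V x
      using g_nonneg G_pos[OF that] by simp
    show "\<exists>N F. openin X N \<and> x \<in> N \<and> finite F \<and> F \<subseteq> \<V> \<and> N \<subseteq> \<Inter>F \<and>
       (\<forall>y\<in>N. (\<forall>V\<in>\<V>-F. g V y / G y = 0) \<and> (\<Sum>V\<in>F. g V y / G y) = 1)"
      if x: "x \<in> topspace X" for x
    proof (intro exI[of _ "N x"] exI[of _ "F x"] conjI ballI)
      fix y assume y: "y \<in> N x"
      then have "0 < G y" using G_pos NF(1)[OF x] openin_subset by blast
      then show "(\<Sum>V\<in>F x. g V y / G y) = 1"
        by (simp add: G_eq[OF x y] flip: sum_divide_distrib)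
    next
      fix y V assume "y \<in> N x" "V \<in> \<V> - F x"
      then show "g V y / G y = 0" using NF(6)[OF x] by simp
    qed (rule NF[OF x])+
  qed
qed

section \<open>Linear combinations in a Banach space on a set\<close>

text \<open>No fibre is named, so one function measures distances in every fibre; it is meaningful
  only for two points of the same fibre.\<close>

definition bundle_dist ::
  "('e \<Rightarrow> 'e \<Rightarrow> 'e) \<Rightarrow> ('k::real_normed_field \<Rightarrow> 'e \<Rightarrow> 'e) \<Rightarrow> ('e \<Rightarrow> real) \<Rightarrow> 'e \<Rightarrow> 'e \<Rightarrow> real" where
  "bundle_dist add smul nrm x y = nrm (add x (smul (-1) y))"

text \<open>The fibre is presented as a multiplicative monoid record, so that finite sums over an
  unordered index set are the finite products of \<open>HOL-Algebra\<close>.\<close>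

definition lincomb ::
  "'e set \<Rightarrow> ('e \<Rightarrow> 'e \<Rightarrow> 'e) \<Rightarrow> ('k::real_normed_field \<Rightarrow> 'e \<Rightarrow> 'e) \<Rightarrow> 'e \<Rightarrow>
    ('i \<Rightarrow> real) \<Rightarrow> ('i \<Rightarrow> 'e) \<Rightarrow> 'i set \<Rightarrow> 'e" where
  "lincomb V add smul zero c y A =
    finprod \<lparr>carrier = V, monoid.mult = add, one = zero\<rparr> (\<lambda>i. smul (of_real (c i)) (y i)) A"

context banach_space_on
begin

abbreviation d where "d \<equiv> bundle_dist add smul nrm"
abbreviation comb where "comb \<equiv> lincomb V add smul zero"

section \<open>Vector and metric identities in one space\<close>

lemma zero_add: "x \<in> V \<Longrightarrow> add zero x = x"
  using add_commute add_zero zero_closed by metis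

lemma add_left_commute: "\<lbrakk>x \<in> V; y \<in> V; z \<in> V\<rbrakk> \<Longrightarrow> add x (add y z) = add y (add x z)"
  using add_assoc add_commute by metis

text \<open>Homogeneity makes the norm of \<open>smul 0 x\<close> vanish, and definiteness of the
  norm does the rest.\<close>

lemma smul_0: "x \<in> V \<Longrightarrow> smul 0 x = zero"
  using nrm_smul[of x 0] nrm_eq_zero smul_closed by simp

lemma add_neg: "x \<in> V \<Longrightarrow> add x (smul (-1) x) = zero"
  using smul_add_left[of x 1 "-1"] smul_0 smul_one by simp

lemma neg_add: "x \<in> V \<Longrightarrow> add (smul (-1) x) x = zero"
  using add_neg add_commute smul_closed by metis

lemma add_diff: "\<lbrakk>x \<in> V; y \<in> V\<rbrakk> \<Longrightarrow> add y (add x (smul (-1) y)) = x"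
  by (simp add: add_left_commute[of y x] smul_closed add_neg add_zero)

lemma d_refl: "x \<in> V \<Longrightarrow> d x x = 0"
  by (simp add: bundle_dist_def add_neg nrm_eq_zero zero_closed)

lemma d_eq_0: "\<lbrakk>x \<in> V; y \<in> V; d x y = 0\<rbrakk> \<Longrightarrow> x = y"
  using add_diff[of x y] add_zero[of y] nrm_eq_zero[of "add x (smul (-1) y)"]
  by (simp add: bundle_dist_def add_closed smul_closed)

lemma d_smul:
  assumes "x \<in> V" "y \<in> V"
  shows "d (smul c x) (smul c y) = norm c * d x y"
  using assms nrm_smul[of "add x (smul (-1) y)" c]
  by (simp add: bundle_dist_def smul_add_right smul_smul smul_closed add_closed)

lemma d_commute:
  assumes "x \<in> V" "y \<in> V"
  shows "d x y = d y x"
proof -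
  have "smul (-1) (add x (smul (-1) y)) = add y (smul (-1) x)"
    using assms
    by (simp add: smul_add_right smul_smul smul_closed smul_one add_commute)
  then show ?thesis
    using nrm_smul[of "add x (smul (-1) y)" "-1"] assms
    by (simp add: bundle_dist_def add_closed smul_closed)
qed

lemma d_triangle:
  assumes "x \<in> V" "y \<in> V" "z \<in> V"
  shows "d x z \<le> d x y + d y z"
proof -
  have "add (add x (smul (-1) y)) (add y (smul (-1) z)) = add x (add (smul (-1) y) (add y (smul (-1) z)))"
    using assms by (simp add: add_assoc smul_closed add_closed)
  also have "\<dots> = add x (smul (-1) z)"
    using assms by (simp add: add_assoc[symmetric, of "smul (-1) y"] smul_closed neg_add zero_add)
  finally show ?thesis
    using nrm_triangle[of "add x (smul (-1) y)" "add y (smul (-1) z)"] assms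
    by (simp add: bundle_dist_def add_closed smul_closed)
qed

lemma d_add:
  assumes "x \<in> V" "y \<in> V" "x' \<in> V" "y' \<in> V"
  shows "d (add x y) (add x' y') \<le> d x x' + d y y'"
proof -
  have "add (add x y) (smul (-1) (add x' y')) =
      add (add x (smul (-1) x')) (add y (smul (-1) y'))"
    using assms
    by (simp add: smul_add_right add_assoc add_left_commute add_closed smul_closed)
  then show ?thesis
    using nrm_triangle[of "add x (smul (-1) x')" "add y (smul (-1) y')"] assms
    by (simp add: bundle_dist_def add_closed smul_closed)
qed

section \<open>Finite linear combinations and convex sets\<close>

lemma comm_monoid: "comm_monoid \<lparr>carrier = V, monoid.mult = add, one = zero\<rparr>"
  by (rule comm_monoidI) 
    (auto simp: add_closed zero_closed add_assoc zero_add add_zero add_commute add_left_commute)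

lemma comb_empty: "comb c y {} = zero"
  using comm_monoid.finprod_empty[OF comm_monoid] by (simp add: lincomb_def)

lemma comb_insert:
  assumes "finite A" "i \<notin> A" "\<And>j. j \<in> insert i A \<Longrightarrow> y j \<in> V"
  shows "comb c y (insert i A) = add (smul (of_real (c i)) (y i)) (comb c y A)"
  unfolding lincomb_def
  by (subst comm_monoid.finprod_insert[OF comm_monoid assms(1,2)])
    (auto intro: smul_closed assms(3))

lemma comb_closed: "(\<And>j. j \<in> A \<Longrightarrow> y j \<in> V) \<Longrightarrow> comb c y A \<in> V"
  using comm_monoid.finprod_closed[OF comm_monoid, of "\<lambda>i. smul (of_real (c i)) (y i)" A]
  by (auto simp: lincomb_def smul_closed)

text \<open>This lets a combination over the support of a partition of unity be computed over a
  larger finite index set that stays fixed near a point.\<close>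

lemma comb_mono_neutral:
  assumes "finite B" "A \<subseteq> B" "\<And>j. j \<in> B - A \<Longrightarrow> c j = 0" "\<And>j. j \<in> B \<Longrightarrow> y j \<in> V"
  shows "comb c y A = comb c y B"
  unfolding lincomb_def
  by (rule comm_monoid.finprod_mono_neutral_cong_left[OF comm_monoid])
    (use assms in \<open>auto simp: smul_0 smul_closed\<close>)

text \<open>With weights from a partition of unity the right-hand side is an average, so a common
  bound on the individual distances carries over to the combinations.\<close>

lemma d_comb_le:
  assumes "finite A" "\<And>i. i \<in> A \<Longrightarrow> y i \<in> V" "\<And>i. i \<in> A \<Longrightarrow> z i \<in> V"
  shows "d (comb c y A) (comb c z A) \<le> (\<Sum>i\<in>A. \<bar>c i\<bar> * d (y i) (z i))"
  using assms
proof (induction A rule: finite_induct)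
  case empty
  then show ?case by (simp add: comb_empty d_refl zero_closed)
next
  case (insert i A)
  have eq: "comb c y (insert i A) = add (smul (of_real (c i)) (y i)) (comb c y A)"
    "comb c z (insert i A) = add (smul (of_real (c i)) (z i)) (comb c z A)"
    by (rule comb_insert[OF insert.hyps], rule insert.prems, assumption)+
  have "d (comb c y (insert i A)) (comb c z (insert i A)) \<le>
      d (smul (of_real (c i)) (y i)) (smul (of_real (c i)) (z i)) + d (comb c y A) (comb c z A)"
    by (subst eq, subst eq, intro d_add smul_closed comb_closed insert.prems) auto
  also have "\<dots> \<le> (\<Sum>i\<in>insert i A. \<bar>c i\<bar> * d (y i) (z i))"
    using insert by (simp add: d_smul)
  finally show ?case .
qed

text \<open>Allowing an arbitrary total weight avoids renormalizing in the induction.\<close>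

lemma comb_convex_scaled:
  assumes C: "bundle_convex add smul C" "C \<subseteq> V" "C \<noteq> {}"
    and "finite A" "\<And>i. i \<in> A \<Longrightarrow> y i \<in> C" "\<And>i. i \<in> A \<Longrightarrow> 0 \<le> c i"
  shows "\<exists>x\<in>C. comb c y A = smul (of_real (\<Sum>i\<in>A. c i)) x"
  using assms(4-)
proof (induction A rule: finite_induct)
  case empty
  obtain x where "x \<in> C" using C(3) by blast
  moreover from this have "smul 0 x = zero" using C(2) smul_0 by blast
  ultimately show ?case by (auto simp: comb_empty intro!: bexI[of _ x])
next
  case (insert i A)
  then obtain x where x: "x \<in> C" "comb c y A = smul (of_real (\<Sum>i\<in>A. c i)) x" by auto
  define a where "a = (\<Sum>i\<in>A. c i)"
  have a: "0 \<le> a" "0 \<le> c i" using insert by (auto simp: a_def intro: sum_nonneg)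
  have yi: "y i \<in> C" "y i \<in> V" "x \<in> V" using insert C x by auto
  have eq: "comb c y (insert i A) = add (smul (of_real (c i)) (y i)) (smul (of_real a) x)"
    using insert C x by (subst comb_insert) (auto simp: a_def)
  show ?case
  proof (cases "c i + a = 0")
    case True
    then have "c i = 0" "a = 0" using a by auto
    then have "comb c y (insert i A) = smul 0 x"
      using eq yi by (simp add: smul_0 add_zero zero_closed)
    moreover have "(\<Sum>i\<in>insert i A. c i) = 0" using True insert by (simp add: a_def)
    ultimately show ?thesis using x(1) by auto
  next
    case False
    \<comment> \<open>\<open>z\<close> is the normalized average of \<open>y i\<close> and the point
      \<open>x\<close> representing the earlier terms; scaling it by \<open>c i + a\<close> restores
      the two weights.\<close>
    define z where "z = add (smul (of_real (c i / (c i + a))) (y i)) (smul (of_real (a / (c i + a))) x)"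
    have "c i / (c i + a) + a / (c i + a) = 1"
      using False by (simp add: add_divide_distrib[symmetric])
    then have z: "z \<in> C"
      using C(1)[unfolded bundle_convex_def, rule_format, OF yi(1) x(1),
          of "c i / (c i + a)" "a / (c i + a)"] a by (simp add: z_def)
    have "smul (of_real (c i + a)) z =
        add (smul (of_real ((c i + a) * (c i / (c i + a)))) (y i))
          (smul (of_real ((c i + a) * (a / (c i + a)))) x)"
      unfolding z_def using yi
      by (simp only: smul_add_right smul_closed smul_smul of_real_mult)
    moreover have "(c i + a) * (c i / (c i + a)) = c i" "(c i + a) * (a / (c i + a)) = a"
      using False by auto
    ultimately have 1: "smul (of_real (c i + a)) z = comb c y (insert i A)"
      unfolding eq by metis
    have "(\<Sum>i\<in>insert i A. c i) = c i + a" using insert by (simp add: a_def)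
    with 1 z show ?thesis by metis
  qed
qed

lemma comb_convex:
  assumes "bundle_convex add smul C" "C \<subseteq> V" "finite A"
    "\<And>i. i \<in> A \<Longrightarrow> y i \<in> C" "\<And>i. i \<in> A \<Longrightarrow> 0 \<le> c i" "(\<Sum>i\<in>A. c i) = 1"
  shows "comb c y A \<in> C"
proof -
  have "A \<noteq> {}" using assms(6) by auto
  then have "C \<noteq> {}" using assms(4) by blast
  with assms(1-5) have "\<exists>x\<in>C. comb c y A = smul (of_real (\<Sum>i\<in>A. c i)) x"
    by (intro comb_convex_scaled) auto
  then obtain x where "x \<in> C" "comb c y A = smul (of_real 1) x"
    unfolding assms(6) by blast
  then show ?thesis using assms(2) by (auto simp: smul_one)
qed

lemma bundle_convex_singleton: "x \<in> V \<Longrightarrow> bundle_convex add smul {x}"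
  unfolding bundle_convex_def
  by (auto simp: smul_one simp flip: smul_add_left of_real_add)

text \<open>The centre \<open>w\<close> equals its own convex combination with weights
  \<open>u\<close> and \<open>v\<close>, so the distance to \<open>w\<close> splits by
  \<open>d_add\<close>.\<close>

lemma bundle_convex_ball:
  assumes "w \<in> V"
  shows "bundle_convex add smul {x \<in> V. d x w < r}"
  unfolding bundle_convex_def
proof safe
  fix x y and u v :: real
  assume x: "x \<in> V" "d x w < r" and y: "y \<in> V" "d y w < r" and uv: "0 \<le> u" "0 \<le> v" "u + v = 1"
  show "add (smul (of_real u) x) (smul (of_real v) y) \<in> V"
    using x y by (simp add: add_closed smul_closed)
  have w: "add (smul (of_real u) w) (smul (of_real v) w) = w"
    using assms uv by (simp add: smul_one flip: smul_add_left of_real_add)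
  have "d (add (smul (of_real u) x) (smul (of_real v) y)) w \<le>
      d (smul (of_real u) x) (smul (of_real u) w) + d (smul (of_real v) y) (smul (of_real v) w)"
    using x y assms by (subst w[symmetric]) (intro d_add smul_closed)
  also have "\<dots> = u * d x w + v * d y w"
    using x y assms uv by (simp add: d_smul)
  also have "\<dots> < r"
    by (rule convex_bound_lt) (use x y uv in auto)
  finally show "d (add (smul (of_real u) x) (smul (of_real v) y)) w < r" .
qed

lemma bundle_convex_Int:
  "bundle_convex add smul C \<Longrightarrow> bundle_convex add smul D \<Longrightarrow> bundle_convex add smul (C \<inter> D)"
  unfolding bundle_convex_def by blast

end

section \<open>Tubes and approximately continuous maps\<close>

context banach_bundle
begin

abbreviation fdist where "fdist \<equiv> bundle_dist add smul nrm"
abbreviation fcomb where "fcomb t \<equiv> lincomb (fiber E p t) add smul (zero t)"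

text \<open>A tube replaces a metric neighbourhood of \<open>W\<close>: points in different fibres
  have no distance, so \<open>W\<close> is thickened along the fibres only.\<close>

definition tube :: "'e set \<Rightarrow> real \<Rightarrow> 'e set" where
  "tube W r = {x \<in> topspace E. \<exists>y\<in>W. p y = p x \<and> fdist x y < r}"

definition approx_continuous :: "'s topology \<Rightarrow> ('s \<Rightarrow> 'e) \<Rightarrow> real \<Rightarrow> bool" where
  "approx_continuous X f r \<longleftrightarrow>
    (\<forall>s\<in>topspace X. \<forall>W. openin E W \<and> f s \<in> W \<longrightarrow>
      (\<exists>N. openin X N \<and> s \<in> N \<and> f ` N \<subseteq> tube W r))"

lemma approx_continuousE:
  assumes "approx_continuous X f r" "s \<in> topspace X" "openin E W" "f s \<in> W"
  obtains N where "openin X N" "s \<in> N" "f ` N \<subseteq> tube W r"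
  using assms(1)[unfolded approx_continuous_def, rule_format, OF assms(2), of W] assms(3,4) that
  by blast

section \<open>Bundle axioms in neighbourhood form\<close>

lemma proj_in_base: "x \<in> topspace E \<Longrightarrow> p x \<in> topspace T"
  using proj_onto by blast

lemma in_fiber: "x \<in> fiber E p t \<longleftrightarrow> x \<in> topspace E \<and> p x = t"
  by (simp add: fiber_def)

lemma openin_proj_vimage: "openin T N \<Longrightarrow> openin E {x \<in> topspace E. p x \<in> N}"
  by (rule openin_continuous_map_preimage[OF proj_continuous])

lemma openin_proj_image: "openin E W \<Longrightarrow> openin T (p ` W)"
  using proj_open by (simp add: open_map_def)

text \<open>The preimage of \<open>W\<close> is open only relative to pairs in a common fibre. It is
  the trace of an open set of the full product, and a box inside that set gives \<open>A\<close> and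
  \<open>B\<close>.\<close>

lemma add_nhds:
  assumes "x \<in> topspace E" "y \<in> topspace E" "p x = p y" "openin E W" "add x y \<in> W"
  shows "\<exists>A B. openin E A \<and> openin E B \<and> x \<in> A \<and> y \<in> B \<and>
    (\<forall>x'\<in>A. \<forall>y'\<in>B. p x' = p y' \<longrightarrow> add x' y' \<in> W)"
proof -
  let ?P = "subtopology (prod_topology E E) {(x, y). p x = p y}"
  have "openin ?P {z \<in> topspace ?P. (case z of (x, y) \<Rightarrow> add x y) \<in> W}"
    by (rule openin_continuous_map_preimage[OF add_continuous assms(4)])
  then obtain Q where Q: "openin (prod_topology E E) Q"
    "{z \<in> topspace ?P. (case z of (x, y) \<Rightarrow> add x y) \<in> W} = Q \<inter> {(x, y). p x = p y}"
    unfolding openin_subtopology by blast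
  have "(x, y) \<in> {z \<in> topspace ?P. (case z of (x, y) \<Rightarrow> add x y) \<in> W}"
    using assms by simp
  then have "(x, y) \<in> Q" unfolding Q(2) by blast
  from openin_prod_topology_alt[THEN iffD1, rule_format, OF Q(1) this]
  obtain A B where AB: "openin E A" "openin E B" "x \<in> A" "y \<in> B" "A \<times> B \<subseteq> Q"
    by (elim exE conjE)
  have "add x' y' \<in> W" if "x' \<in> A" "y' \<in> B" "p x' = p y'" for x' y'
  proof -
    have "(x', y') \<in> Q \<inter> {(x, y). p x = p y}" using that AB by blast
    then show ?thesis unfolding Q(2)[symmetric] by simp
  qed
  with AB show ?thesis by blast
qed

lemma smul_nhds:
  assumes "x \<in> topspace E" "openin E W" "smul c x \<in> W"
  shows "\<exists>A B. open A \<and> openin E B \<and> c \<in> A \<and> x \<in> B \<and> (\<forall>c'\<in>A. \<forall>x'\<in>B. smul c' x' \<in> W)"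
proof -
  let ?P = "prod_topology euclidean E"
  have "openin ?P {z \<in> topspace ?P. (case z of (c, x) \<Rightarrow> smul c x) \<in> W}" (is "openin _ ?Q")
    by (rule openin_continuous_map_preimage[OF smul_continuous assms(2)])
  moreover have "(c, x) \<in> ?Q" using assms by simp
  ultimately have "\<exists>A B. openin euclidean A \<and> openin E B \<and> c \<in> A \<and> x \<in> B \<and> A \<times> B \<subseteq> ?Q"
    by (rule openin_prod_topology_alt[THEN iffD1, rule_format])
  then obtain A B where A: "openin euclidean A" and AB: "openin E B" "c \<in> A" "x \<in> B" "A \<times> B \<subseteq> ?Q"
    by (elim exE conjE)
  have "open A" using A by (rule open_openin[THEN iffD2])
  with AB show ?thesis by (intro exI[of _ A] exI[of _ B]) auto
qed

lemma smul_real_nhds: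
  assumes "x \<in> topspace E" "openin E W" "smul (of_real c) x \<in> W"
  shows "\<exists>\<delta>>0. \<exists>B. openin E B \<and> x \<in> B \<and> (\<forall>c'. \<forall>x'\<in>B. \<bar>c' - c\<bar> < \<delta> \<longrightarrow> smul (of_real c') x' \<in> W)"
proof -
  from smul_nhds[OF assms]
  obtain A B where AB: "open A" "openin E B" "of_real c \<in> A" "x \<in> B"
    "\<forall>c'\<in>A. \<forall>x'\<in>B. smul c' x' \<in> W"
    by (elim exE conjE)
  obtain \<delta> where "\<delta> > 0" "\<And>c'. dist c' (of_real c) < \<delta> \<Longrightarrow> c' \<in> A"
    using AB(1,3) unfolding open_dist by blast
  then show ?thesis using AB
    by (intro exI[of _ \<delta>] conjI exI[of _ B])
      (auto simp: dist_norm norm_of_real simp flip: of_real_diff)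
qed

text \<open>Upper semicontinuity makes \<open>{z. nrm z < r}\<close> open, and the difference of two
  points depends continuously on both, so strict upper bounds on fibre distances persist
  nearby.\<close>

lemma fdist_nhds:
  assumes "x \<in> topspace E" "y \<in> topspace E" "p x = p y" "fdist x y < r"
  shows "\<exists>A B. openin E A \<and> openin E B \<and> x \<in> A \<and> y \<in> B \<and>
    (\<forall>x'\<in>A. \<forall>y'\<in>B. p x' = p y' \<longrightarrow> fdist x' y' < r)"
proof -
  interpret B: banach_space_on "fiber E p (p x)" add smul "zero (p x)" nrm
    by (rule fiber_banach[OF proj_in_base[OF assms(1)]])
  have "x \<in> fiber E p (p x)" "y \<in> fiber E p (p x)" using assms by (simp_all add: in_fiber)
  then have y: "smul (-1) y \<in> fiber E p (p x)" and "add x (smul (-1) y) \<in> fiber E p (p x)"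
    by (simp_all add: B.smul_closed B.add_closed)
  then have y: "smul (-1) y \<in> fiber E p (p x)" "smul (-1) y \<in> topspace E" "p x = p (smul (-1) y)"
    and xy: "add x (smul (-1) y) \<in> {z \<in> topspace E. nrm z < r}"
    using assms(4) by (simp_all add: in_fiber bundle_dist_def)
  from add_nhds[OF assms(1) y(2,3) nrm_upper_semicontinuous[of r] xy]
  obtain A C where AC: "openin E A" "openin E C" "x \<in> A" "smul (-1) y \<in> C"
    "\<forall>x'\<in>A. \<forall>y'\<in>C. p x' = p y' \<longrightarrow> add x' y' \<in> {z \<in> topspace E. nrm z < r}"
    by (elim exE conjE)
  from smul_nhds[OF assms(2) AC(2,4)]
  obtain K B where KB: "open K" "openin E B" "-1 \<in> K" "y \<in> B" "\<forall>c'\<in>K. \<forall>x'\<in>B. smul c' x' \<in> C"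
    by (elim exE conjE)
  have "fdist x' y' < r" if xy': "x' \<in> A" "y' \<in> B" "p x' = p y'" for x' y'
  proof -
    have y': "y' \<in> fiber E p (p y')" using xy'(2) openin_subset[OF KB(2)] by (auto simp: in_fiber)
    then have "smul (-1) y' \<in> fiber E p (p y')"
      by (intro banach_space_on.smul_closed[OF fiber_banach]) (auto simp: in_fiber intro: proj_in_base)
    then show ?thesis using xy' KB AC(5) by (simp add: in_fiber bundle_dist_def)
  qed
  then show ?thesis using AC KB by blast
qed

lemma thin_nhd:
  assumes "x \<in> topspace E" "0 < r"
  shows "\<exists>U. openin E U \<and> x \<in> U \<and> (\<forall>y\<in>U. \<forall>z\<in>U. p y = p z \<longrightarrow> fdist y z < r)"
proof -
  have "fdist x x < r"
    using banach_space_on.d_refl[OF fiber_banach[OF proj_in_base[OF assms(1)]]] assms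
    by (simp add: in_fiber)
  from fdist_nhds[OF assms(1,1) refl this]
  obtain A B where AB: "openin E A" "openin E B" "x \<in> A" "x \<in> B"
    "\<forall>x'\<in>A. \<forall>y'\<in>B. p x' = p y' \<longrightarrow> fdist x' y' < r"
    by (elim exE conjE)
  then show ?thesis by (intro exI[of _ "A \<inter> B"]) auto
qed

text \<open>When \<open>x\<close> moves, its base point moves too, and a new partner in
  \<open>W\<close> is needed in the new fibre. Openness of \<open>p\<close> supplies it: nearby
  fibres still meet \<open>B \<inter> W\<close>.\<close>

lemma openin_tube:
  assumes "openin E W"
  shows "openin E (tube W r)"
proof (subst openin_subopen, intro ballI)
  fix x assume "x \<in> tube W r"
  then obtain y where x: "x \<in> topspace E" and y: "y \<in> W" "p y = p x" "fdist x y < r"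
    by (auto simp: tube_def)
  have y': "y \<in> topspace E" "p x = p y" using y openin_subset[OF assms] by auto
  from fdist_nhds[OF x y'(1,2) y(3)]
  obtain A B where AB: "openin E A" "openin E B" "x \<in> A" "y \<in> B"
    "\<forall>x'\<in>A. \<forall>y'\<in>B. p x' = p y' \<longrightarrow> fdist x' y' < r"
    by (elim exE conjE)
  let ?N = "A \<inter> {x \<in> topspace E. p x \<in> p ` (B \<inter> W)}"
  have "openin E ?N"
    using AB assms by (intro openin_Int openin_proj_vimage openin_proj_image) auto
  moreover have "x \<in> ?N" using x y AB by (auto intro!: image_eqI[of "p x" p y])
  moreover have "?N \<subseteq> tube W r" using AB(5) by (fastforce simp: tube_def)
  ultimately show "\<exists>N. openin E N \<and> x \<in> N \<and> N \<subseteq> tube W r" by blast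
qed

text \<open>The filter axiom \<open>zero_limit\<close> becomes a concrete neighbourhood statement:
  around the zero vector, open sets contain all short vectors over a neighbourhood of
  \<open>t\<close>.\<close>

lemma zero_nhds:
  assumes t: "t \<in> topspace T" and W: "openin E W" "zero t \<in> W"
  shows "\<exists>N \<delta>. openin T N \<and> t \<in> N \<and> 0 < \<delta> \<and> (\<forall>z\<in>topspace E. p z \<in> N \<and> nrm z < \<delta> \<longrightarrow> z \<in> W)"
proof -
  \<comment> \<open>\<open>F\<close> is the coarsest filter concentrated on the bundle space along
    which \<open>p\<close> tends to \<open>t\<close> and \<open>nrm\<close> tends to
    \<open>0\<close>. Unpacking eventuality in \<open>F\<close> therefore returns exactly a set
    \<open>N\<close> and a bound \<open>\<delta>\<close>.\<close>
  define F where "F = inf (inf (filtercomap p (nhdsin T t)) (filtercomap nrm (nhds 0))) (principal (topspace E))"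
  have "\<forall>\<^sub>F x in F. x \<in> topspace E"
    unfolding F_def by (simp add: eventually_inf_principal)
  moreover have "limitin T p t F"
    unfolding limitin_def
  proof (intro conjI t allI impI, elim conjE)
    fix U assume "openin T U" "t \<in> U"
    then have "eventually (\<lambda>x. x \<in> U) (nhdsin T t)"
      unfolding eventually_nhdsin by (intro disjI2 exI[of _ U]) simp
    then have "eventually (\<lambda>x. p x \<in> U) (filtercomap p (nhdsin T t))"
      by (rule eventually_filtercomapI)
    then show "eventually (\<lambda>x. p x \<in> U) F"
      by (rule filter_leD[rotated]) (unfold F_def, intro le_infI1 order_refl)
  qed
  moreover have "(nrm \<longlongrightarrow> 0) F"
    unfolding F_def
    by (rule filterlim_mono[OF filterlim_filtercomap order_refl]) (intro le_infI1 le_infI2 order_refl)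
  ultimately have "limitin E (\<lambda>x. x) (zero t) F" by (rule zero_limit)
  then have "eventually (\<lambda>x. x \<in> W) F" using W by (auto simp: limitin_def)
  from this[unfolded F_def eventually_inf_principal, THEN eventually_inf[THEN iffD1]]
  obtain P' Q' where P': "eventually P' (filtercomap p (nhdsin T t))"
    and Q': "eventually Q' (filtercomap nrm (nhds 0))"
    and PQ': "\<forall>x. P' x \<and> Q' x \<longrightarrow> x \<in> topspace E \<longrightarrow> x \<in> W"
    by (elim exE conjE)
  from P'[unfolded eventually_filtercomap]
  obtain P where P: "eventually P (nhdsin T t)" "\<forall>x. P (p x) \<longrightarrow> P' x"
    by (elim exE conjE)
  from Q'[unfolded eventually_filtercomap]
  obtain Q where Q: "eventually Q (nhds (0::real))" "\<forall>x. Q (nrm x) \<longrightarrow> Q' x"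
    by (elim exE conjE)
  obtain N where "openin T N" "t \<in> N" "\<forall>x\<in>N. P x"
    using P(1) t unfolding eventually_nhdsin by blast
  moreover obtain \<delta> where "0 < \<delta>" "\<And>x. dist x 0 < \<delta> \<Longrightarrow> Q x"
    using Q(1) unfolding eventually_nhds_metric by blast
  \<comment> \<open>Nonnegativity turns the ball around \<open>0\<close> into the one-sided
    condition \<open>nrm z < \<delta>\<close>.\<close>
  moreover have "0 \<le> nrm z" if "z \<in> topspace E" for z
    using banach_space_on.nrm_nonneg[OF fiber_banach[OF proj_in_base[OF that]]] that
    by (simp add: in_fiber)
  ultimately show ?thesis
    using PQ' P(2) Q(2) by (intro exI[of _ N] exI[of _ \<delta>]) (auto simp: dist_norm)
qed

text \<open>A point \<open>v\<close> of a tube is \<open>y\<close> plus the short vector from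
  \<open>y\<close> to \<open>v\<close>. Continuity of addition at \<open>x\<close> and the zero
  vector, with \<open>zero_nhds\<close> for the short vector, keeps the sum in
  \<open>W\<close>.\<close>

lemma small_tube:
  assumes W: "openin E W" "x \<in> W"
  shows "\<exists>W' \<delta>. openin E W' \<and> x \<in> W' \<and> 0 < \<delta> \<and> tube W' \<delta> \<subseteq> W"
proof -
  have x: "x \<in> topspace E" using W openin_subset by blast
  note t = proj_in_base[OF x]
  interpret B: banach_space_on "fiber E p (p x)" add smul "zero (p x)" nrm
    by (rule fiber_banach[OF t])
  have z: "zero (p x) \<in> topspace E" "p (zero (p x)) = p x"
    using B.zero_closed by (auto simp: in_fiber)
  have "add x (zero (p x)) \<in> W" using B.add_zero[of x] x W by (simp add: in_fiber)
  from add_nhds[OF x z(1) z(2)[symmetric] W(1) this]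
  obtain A C where AC: "openin E A" "openin E C" "x \<in> A" "zero (p x) \<in> C"
    "\<forall>x'\<in>A. \<forall>y'\<in>C. p x' = p y' \<longrightarrow> add x' y' \<in> W"
    by (elim exE conjE)
  from zero_nhds[OF t AC(2,4)]
  obtain N \<delta> where N: "openin T N" "p x \<in> N" "0 < \<delta>"
    "\<forall>z\<in>topspace E. p z \<in> N \<and> nrm z < \<delta> \<longrightarrow> z \<in> C"
    by (elim exE conjE)
  let ?W = "A \<inter> {x \<in> topspace E. p x \<in> N}"
  have "v \<in> W" if vt: "v \<in> tube ?W \<delta>" for v
  proof -
    obtain y where "y \<in> ?W" "p y = p v" "fdist v y < \<delta>" and v: "v \<in> topspace E"
      using vt unfolding tube_def by blast
    then have y: "y \<in> A" "y \<in> topspace E" "p v \<in> N" "p y = p v" "fdist v y < \<delta>"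
      by auto
    interpret V: banach_space_on "fiber E p (p v)" add smul "zero (p v)" nrm
      by (rule fiber_banach[OF proj_in_base[OF v]])
    have fib: "v \<in> fiber E p (p v)" "y \<in> fiber E p (p v)" using v y by (auto simp: in_fiber)
    then have "add v (smul (-1) y) \<in> fiber E p (p v)"
      by (intro V.add_closed V.smul_closed)
    then have "add v (smul (-1) y) \<in> C" "p (add v (smul (-1) y)) = p v"
      using y N(4) by (simp_all add: in_fiber bundle_dist_def)
    then have "add y (add v (smul (-1) y)) \<in> W" using AC(5) y by simp
    then show ?thesis by (simp add: V.add_diff[OF fib])
  qed
  moreover have "openin E ?W" using AC N by (intro openin_Int openin_proj_vimage)
  ultimately show ?thesis using AC N x by (intro exI[of _ ?W] exI[of _ \<delta>]) auto
qed

lemma tube_trans: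
  assumes "x \<in> topspace E" "y \<in> tube W r" "p x = p y" "fdist x y < r'" "W \<subseteq> topspace E"
  shows "x \<in> tube W (r + r')"
proof -
  obtain w where w: "w \<in> W" "p w = p y" "fdist y w < r" and y: "y \<in> topspace E"
    using assms(2) by (auto simp: tube_def)
  interpret B: banach_space_on "fiber E p (p x)" add smul "zero (p x)" nrm
    by (rule fiber_banach[OF proj_in_base[OF assms(1)]])
  have "fdist x w \<le> fdist x y + fdist y w"
    by (rule B.d_triangle) (use assms w y in \<open>auto simp: in_fiber\<close>)
  then show ?thesis using assms w by (auto simp: tube_def intro!: bexI[of _ w])
qed

lemma approx_continuous_mono:
  assumes "approx_continuous X f r" "r \<le> r'"
  shows "approx_continuous X f r'"
  unfolding approx_continuous_def
proof (intro ballI allI impI, elim conjE)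
  fix s W assume "s \<in> topspace X" "openin E W" "f s \<in> W"
  then obtain N where "openin X N" "s \<in> N" "f ` N \<subseteq> tube W r"
    by (rule approx_continuousE[OF assms(1)])
  moreover have "tube W r \<subseteq> tube W r'"
    using assms(2) by (force simp: tube_def)
  ultimately show "\<exists>N. openin X N \<and> s \<in> N \<and> f ` N \<subseteq> tube W r'" by blast
qed

text \<open>Both the jumps of the approximants and their distance to \<open>f\<close> can be made
  smaller than the width of a tube that fits into the given open set.\<close>

lemma continuous_map_uniform_limit:
  assumes f: "\<And>s. s \<in> topspace X \<Longrightarrow> f s \<in> topspace E"
    and approx: "\<And>r. 0 < r \<Longrightarrow> \<exists>g. approx_continuous X g r \<and>
      (\<forall>s\<in>topspace X. g s \<in> topspace E \<and> p (g s) = p (f s) \<and> fdist (g s) (f s) < r)"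
  shows "continuous_map X E f"
  unfolding continuous_map_def
proof (intro conjI allI impI)
  show "f \<in> topspace X \<rightarrow> topspace E" using f by blast
  fix W assume W: "openin E W"
  show "openin X {s \<in> topspace X. f s \<in> W}"
  proof (subst openin_subopen, intro ballI)
    fix s assume "s \<in> {s \<in> topspace X. f s \<in> W}"
    then have s: "s \<in> topspace X" "f s \<in> W" by auto
    from small_tube[OF W s(2)]
    obtain W' \<delta> where W': "openin E W'" "f s \<in> W'" "0 < \<delta>" "tube W' \<delta> \<subseteq> W"
      by (elim exE conjE)
    \<comment> \<open>Three errors add up: from \<open>f s\<close> to \<open>g s\<close>, the jump
      of \<open>g\<close> near \<open>s\<close>, and from \<open>g s'\<close> back to
      \<open>f s'\<close>. The first one needs \<open>tube W' r\<close> to be open, so that it can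
      serve as the neighbourhood of \<open>g s\<close> in approximate continuity.\<close>
    define r where "r = \<delta> / 3"
    have "0 < r" using W'(3) by (simp add: r_def)
    from approx[OF this] obtain g where g: "approx_continuous X g r"
      "\<And>s. s\<in>topspace X \<Longrightarrow> g s \<in> topspace E" "\<And>s. s\<in>topspace X \<Longrightarrow> p (g s) = p (f s)"
      "\<And>s. s\<in>topspace X \<Longrightarrow> fdist (g s) (f s) < r"
      by blast
    have "g s \<in> tube W' r" using g s W' by (auto simp: tube_def intro!: bexI[of _ "f s"])
    then obtain N where N: "openin X N" "s \<in> N" "g ` N \<subseteq> tube (tube W' r) r"
      by (rule approx_continuousE[OF g(1) s(1) openin_tube[OF W'(1)]])
    have "f s' \<in> W" if "s' \<in> N" for s'
    proof -
      have s': "s' \<in> topspace X" using that N openin_subset by blast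
      then interpret B: banach_space_on "fiber E p (p (f s'))" add smul "zero (p (f s'))" nrm
        using f by (intro fiber_banach proj_in_base)
      have "fdist (f s') (g s') < r"
        using g(4)[OF s'] B.d_commute[of "f s'" "g s'"] f g(2,3) s' by (simp add: in_fiber)
      moreover have "g s' \<in> tube (tube W' r) r" using N(3) that by blast
      ultimately have "f s' \<in> tube (tube W' r) (r + r)"
        using f g(3) s' openin_subset[OF openin_tube[OF W'(1)]]
        by (intro tube_trans) auto
      then obtain y where "y \<in> tube W' r" "p y = p (f s')" "fdist (f s') y < r + r"
        unfolding tube_def[of "tube W' r"] by blast
      then have "f s' \<in> tube W' (r + (r + r))"
        using f s' openin_subset[OF W'(1)] by (intro tube_trans) auto
      then show ?thesis using W'(4) by (auto simp: r_def)
    qed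
    then show "\<exists>N. openin X N \<and> s \<in> N \<and> N \<subseteq> {s \<in> topspace X. f s \<in> W}"
      using N openin_subset by blast
  qed
qed

text \<open>This is joint continuity of a finite combination in base point, weights and vectors.
  Induction on \<open>F\<close> adds one term by continuity of the operations; the empty sum is the
  zero section, whose continuity is \<open>zero_nhds\<close> applied to vectors of norm
  \<open>0\<close>.\<close>

lemma fcomb_nhds:
  assumes "finite F" and t: "t \<in> topspace T" and "\<forall>i\<in>F. y i \<in> fiber E p t"
    and "openin E W" "fcomb t c y F \<in> W"
  shows "\<exists>\<delta> N Q. 0 < \<delta> \<and> openin T N \<and> t \<in> N \<and> (\<forall>i\<in>F. openin E (Q i) \<and> y i \<in> Q i) \<and>
    (\<forall>t'\<in>N. \<forall>c' z. (\<forall>i\<in>F. \<bar>c' i - c i\<bar> < \<delta> \<and> z i \<in> Q i \<inter> fiber E p t') \<longrightarrow> fcomb t' c' z F \<in> W)"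
  using assms(1,3-)
proof (induction F arbitrary: W rule: finite_induct)
  case empty
  interpret B: banach_space_on "fiber E p t" add smul "zero t" nrm
    by (rule fiber_banach[OF t])
  have "zero t \<in> W" using empty by (simp add: B.comb_empty)
  from zero_nhds[OF t empty(2) this]
  obtain N \<delta> where N: "openin T N" "t \<in> N" "0 < \<delta>"
    "\<forall>z\<in>topspace E. p z \<in> N \<and> nrm z < \<delta> \<longrightarrow> z \<in> W"
    by (elim exE conjE)
  have "fcomb t' c' z {} \<in> W" if "t' \<in> N" for t' c' z
  proof -
    interpret B': banach_space_on "fiber E p t'" add smul "zero t'" nrm
      using that N(1) openin_subset by (intro fiber_banach) blast
    show ?thesis
      using B'.zero_closed N(3) that B'.nrm_eq_zero[OF B'.zero_closed] N(4)
      by (simp add: B'.comb_empty in_fiber)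
  qed
  then show ?case using N by blast
next
  case (insert j F)
  interpret B: banach_space_on "fiber E p t" add smul "zero t" nrm
    by (rule fiber_banach[OF t])
  have yj: "y j \<in> fiber E p t" and yF: "\<forall>i\<in>F. y i \<in> fiber E p t"
    using insert.prems(1) by simp_all
  have a: "smul (of_real (c j)) (y j) \<in> fiber E p t" and b: "fcomb t c y F \<in> fiber E p t"
    using yj yF by (auto intro: B.smul_closed B.comb_closed)
  then have ab: "smul (of_real (c j)) (y j) \<in> topspace E" "fcomb t c y F \<in> topspace E"
    "p (smul (of_real (c j)) (y j)) = p (fcomb t c y F)" and yE: "y j \<in> topspace E"
    using yj by (simp_all add: in_fiber)
  have "add (smul (of_real (c j)) (y j)) (fcomb t c y F) \<in> W"
    by (subst B.comb_insert[OF insert.hyps, symmetric]) (use insert.prems in auto)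
  from add_nhds[OF ab insert.prems(2) this]
  obtain A C where AC: "openin E A" "openin E C" "smul (of_real (c j)) (y j) \<in> A"
    "fcomb t c y F \<in> C" "\<forall>x'\<in>A. \<forall>y'\<in>C. p x' = p y' \<longrightarrow> add x' y' \<in> W"
    by (elim exE conjE)
  from smul_real_nhds[OF yE AC(1,3)]
  obtain \<delta>1 Qj where Qj: "0 < \<delta>1" "openin E Qj" "y j \<in> Qj"
    "\<forall>c'. \<forall>x'\<in>Qj. \<bar>c' - c j\<bar> < \<delta>1 \<longrightarrow> smul (of_real c') x' \<in> A"
    by (elim exE conjE)
  from insert.IH[OF yF AC(2,4)] obtain \<delta>2 N Q where Q: "0 < \<delta>2" "openin T N" "t \<in> N"
    "\<forall>i\<in>F. openin E (Q i) \<and> y i \<in> Q i"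
    "\<forall>t'\<in>N. \<forall>c' z. (\<forall>i\<in>F. \<bar>c' i - c i\<bar> < \<delta>2 \<and> z i \<in> Q i \<inter> fiber E p t') \<longrightarrow> fcomb t' c' z F \<in> C"
    by (elim exE conjE)
  let ?Q = "Q(j := Qj)"
  have "fcomb t' c' z (insert j F) \<in> W"
    if t': "t' \<in> N"
      and h: "\<forall>i\<in>insert j F. \<bar>c' i - c i\<bar> < min \<delta>1 \<delta>2 \<and> z i \<in> ?Q i \<inter> fiber E p t'" for t' c' z
  proof -
    interpret B': banach_space_on "fiber E p t'" add smul "zero t'" nrm
      using t' Q(2) openin_subset by (intro fiber_banach) blast
    have h': "\<bar>c' i - c i\<bar> < \<delta>2 \<and> z i \<in> Q i \<inter> fiber E p t'" if "i \<in> F" for i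
    proof -
      have "i \<noteq> j" using that insert by auto
      then show ?thesis using h that by auto
    qed
    have 1: "smul (of_real (c' j)) (z j) \<in> A" using h Qj(4) by simp
    have 2: "fcomb t' c' z F \<in> C" using Q(5)[rule_format, OF t'] h' by blast
    have 3: "smul (of_real (c' j)) (z j) \<in> fiber E p t'" using h by (intro B'.smul_closed) auto
    have 4: "fcomb t' c' z F \<in> fiber E p t'" using h' by (intro B'.comb_closed) auto
    have "add (smul (of_real (c' j)) (z j)) (fcomb t' c' z F) \<in> W"
      using AC(5) 1 2 3 4 by (simp add: in_fiber)
    then show ?thesis using insert.hyps h by (subst B'.comb_insert) auto
  qed
  moreover have "\<forall>i\<in>insert j F. openin E (?Q i) \<and> y i \<in> ?Q i"
    using Q Qj by auto
  ultimately show ?case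
    using Q Qj by (intro exI[of _ "min \<delta>1 \<delta>2"] exI[of _ N] exI[of _ ?Q]) auto
qed

section \<open>Selections\<close>

text \<open>The chosen points \<open>y V s\<close> may jump, but near \<open>s\<close> each can be
  traded for a point \<open>z V\<close> of the same fibre close to the old \<open>y V s\<close>.
  Both lie in the thin set \<open>U V\<close>, so the trade costs less than \<open>r/2\<close>, and
  the combination of the \<open>z V\<close> lies in \<open>W\<close> by
  \<open>fcomb_nhds\<close>.\<close>

lemma approx_continuous_selection:
  fixes S :: "'s topology"
  assumes S: "paracompact_space S" and \<pi>: "continuous_map S T \<pi>"
    and fib: "\<And>s. s \<in> topspace S \<Longrightarrow> \<Psi> s \<subseteq> fiber E p (\<pi> s)"
    and conv: "\<And>s. s \<in> topspace S \<Longrightarrow> bundle_convex add smul (\<Psi> s)"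
    and lsc: "\<And>s. s \<in> topspace S \<Longrightarrow> \<exists>x\<in>fiber E p (\<pi> s). \<forall>W. openin E W \<and> x \<in> W \<longrightarrow>
        (\<exists>N. openin S N \<and> s \<in> N \<and> (\<forall>s'\<in>N. \<Psi> s' \<inter> W \<noteq> {}))"
    and r: "0 < r"
  shows "\<exists>f. approx_continuous S f r \<and> (\<forall>s\<in>topspace S. f s \<in> \<Psi> s)"
proof -
  have base: "\<pi> s \<in> topspace T" if "s \<in> topspace S" for s
    using \<pi> that by (auto simp: continuous_map_def)
  \<comment> \<open>The averaged distance is only bounded weakly, by \<open>r/2\<close>; halving
    recovers a strict bound by \<open>r\<close>.\<close>
  define thin where "thin U \<longleftrightarrow> openin E U \<and> (\<forall>y\<in>U. \<forall>z\<in>U. p y = p z \<longrightarrow> fdist y z < r/2)" for U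
  define P where "P V \<longleftrightarrow> (\<exists>U. thin U \<and> (\<forall>s\<in>V. \<Psi> s \<inter> U \<noteq> {}))" for V
  have cover: "\<forall>s\<in>topspace S. \<exists>N. openin S N \<and> s \<in> N \<and> P N"
  proof
    fix s assume s: "s \<in> topspace S"
    obtain x where x: "x \<in> fiber E p (\<pi> s)" "\<And>W. openin E W \<and> x \<in> W \<Longrightarrow>
        \<exists>N. openin S N \<and> s \<in> N \<and> (\<forall>s'\<in>N. \<Psi> s' \<inter> W \<noteq> {})"
      using lsc[OF s] by blast
    have "x \<in> topspace E" "0 < r/2" using x(1) r by (simp_all add: in_fiber)
    from thin_nhd[OF this] obtain U where "thin U" "x \<in> U"
      unfolding thin_def by blast
    then show "\<exists>N. openin S N \<and> s \<in> N \<and> P N"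
      using x(2)[of U] unfolding P_def thin_def by blast
  qed
  have mono: "\<forall>U V. P U \<longrightarrow> V \<subseteq> U \<longrightarrow> P V"
    unfolding P_def by blast
  from paracompact_partition_of_unity[OF S, of P, OF cover mono]
  obtain \<V> and \<phi> :: "'s set \<Rightarrow> 's \<Rightarrow> real" where \<V>:
    "\<forall>V\<in>\<V>. openin S V \<and> P V \<and> continuous_map S euclideanreal (\<phi> V) \<and> (\<forall>s\<in>topspace S. 0 \<le> \<phi> V s)"
    and loc: "\<forall>s\<in>topspace S. \<exists>N F. openin S N \<and> s \<in> N \<and> finite F \<and> F \<subseteq> \<V> \<and> N \<subseteq> \<Inter>F \<and>
       (\<forall>s'\<in>N. (\<forall>V\<in>\<V>-F. \<phi> V s' = 0) \<and> (\<Sum>V\<in>F. \<phi> V s') = 1)"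
    by (elim exE conjE)
  have \<phi>_nonneg: "0 \<le> \<phi> V s" if "V \<in> \<V>" "s \<in> topspace S" for V s
    using \<V> that by blast
  have "\<forall>V\<in>\<V>. \<exists>U. thin U \<and> (\<forall>s\<in>V. \<Psi> s \<inter> U \<noteq> {})"
    using \<V> unfolding P_def by blast
  from bchoice[OF this]
  obtain U where U: "\<And>V. V \<in> \<V> \<Longrightarrow> thin (U V)" "\<And>V s. V \<in> \<V> \<Longrightarrow> s \<in> V \<Longrightarrow> \<Psi> s \<inter> U V \<noteq> {}"
    by blast
  \<comment> \<open>For \<open>s\<close> outside \<open>V\<close> the value may be arbitrary. It
    never enters \<open>f\<close>, because a nonzero weight puts \<open>V\<close> into the local
    family \<open>F\<close> at \<open>s\<close>, all of whose members contain
    \<open>s\<close>.\<close>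
  define y where "y V s = (SOME x. x \<in> \<Psi> s \<inter> U V)" for V s
  have y: "y V s \<in> \<Psi> s" "y V s \<in> U V" if "V \<in> \<V>" "s \<in> V" for V s
    using U(2)[OF that] some_in_eq[of "\<Psi> s \<inter> U V"] by (auto simp: y_def)
  define f where "f s = fcomb (\<pi> s) (\<lambda>V. \<phi> V s) (\<lambda>V. y V s) {V \<in> \<V>. \<phi> V s \<noteq> 0}" for s
  have f_loc: "f s = fcomb (\<pi> s) (\<lambda>V. \<phi> V s) (\<lambda>V. y V s) F"
    if "s \<in> topspace S" "finite F" "F \<subseteq> \<V>" "s \<in> \<Inter>F" "\<forall>V\<in>\<V>-F. \<phi> V s = 0" for s F
    unfolding f_def
    by (rule banach_space_on.comb_mono_neutral[OF fiber_banach[OF base]])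
      (use that y(1) fib in blast)+
  have sel: "f s \<in> \<Psi> s" if s: "s \<in> topspace S" for s
  proof -
    from loc[rule_format, OF s]
    obtain N F where NF: "s \<in> N" "finite F" "F \<subseteq> \<V>" "N \<subseteq> \<Inter>F"
       "\<forall>s'\<in>N. (\<forall>V\<in>\<V>-F. \<phi> V s' = 0) \<and> (\<Sum>V\<in>F. \<phi> V s') = 1"
      by (elim exE conjE)
    have eq: "f s = fcomb (\<pi> s) (\<lambda>V. \<phi> V s) (\<lambda>V. y V s) F"
      by (rule f_loc) (use s NF in auto)
    show ?thesis
      unfolding eq
      by (rule banach_space_on.comb_convex[OF fiber_banach[OF base[OF s]] conv[OF s] fib[OF s] NF(2)])
        (use NF y(1) \<phi>_nonneg s in blast)+
  qed
  have "\<exists>N. openin S N \<and> s \<in> N \<and> f ` N \<subseteq> tube W r"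
    if s: "s \<in> topspace S" and W: "openin E W" "f s \<in> W" for s W
  proof -
    from loc[rule_format, OF s]
    obtain N F where NF: "openin S N" "s \<in> N" "finite F" "F \<subseteq> \<V>" "N \<subseteq> \<Inter>F"
       "\<forall>s'\<in>N. (\<forall>V\<in>\<V>-F. \<phi> V s' = 0) \<and> (\<Sum>V\<in>F. \<phi> V s') = 1"
      by (elim exE conjE)
    have N: "N \<subseteq> topspace S" using NF(1) openin_subset by blast
    have eq: "f s' = fcomb (\<pi> s') (\<lambda>V. \<phi> V s') (\<lambda>V. y V s') F" if "s' \<in> N" for s'
      by (rule f_loc) (use that NF N in auto)
    have yF: "y V s' \<in> fiber E p (\<pi> s')" "y V s' \<in> U V" if "V \<in> F" "s' \<in> N" for V s'
      using that NF N y fib by blast+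
    have UF: "openin E (U V)" if "V \<in> F" for V
      using that NF(4) U(1) unfolding thin_def by blast
    have "\<forall>V\<in>F. y V s \<in> fiber E p (\<pi> s)" "fcomb (\<pi> s) (\<lambda>V. \<phi> V s) (\<lambda>V. y V s) F \<in> W"
      using yF(1) NF(2) W(2) eq by auto
    from fcomb_nhds[OF NF(3) base[OF s] this(1) W(1) this(2)]
    obtain \<delta> M Q where \<delta>: "0 < \<delta>" and M: "openin T M" "\<pi> s \<in> M"
      and Q: "\<forall>V\<in>F. openin E (Q V) \<and> y V s \<in> Q V"
      and QW: "\<forall>t'\<in>M. \<forall>c' z. (\<forall>V\<in>F. \<bar>c' V - \<phi> V s\<bar> < \<delta> \<and> z V \<in> Q V \<inter> fiber E p t') \<longrightarrow>
        fcomb t' c' z F \<in> W"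
      by (elim exE conjE)
    \<comment> \<open>The first part guarantees that the fibre over \<open>\<pi> s'\<close> meets
      \<open>Q V \<inter> U V\<close>, from which \<open>z V\<close> is drawn; it is open since
      \<open>p\<close> is open and \<open>\<pi>\<close> continuous. The second part keeps the weight
      within \<open>\<delta>\<close>.\<close>
    define K where "K V = {s' \<in> topspace S. \<pi> s' \<in> p ` (Q V \<inter> U V)} \<inter>
      {s' \<in> topspace S. \<phi> V s' \<in> ball (\<phi> V s) \<delta>}" for V
    define N' where "N' = \<Inter>(insert N (insert {s' \<in> topspace S. \<pi> s' \<in> M} (K ` F)))"
    have K: "openin S (K V)" "s \<in> K V" if V: "V \<in> F" for V
    proof -
      show "openin S (K V)"
        unfolding K_def using V UF Q \<V> NF(4)
        by (intro openin_Int openin_continuous_map_preimage[OF \<pi>]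
            openin_continuous_map_preimage[where Y = euclideanreal] openin_proj_image) auto
      have "p (y V s) = \<pi> s" using yF(1)[OF V NF(2)] by (simp add: in_fiber)
      then have "\<pi> s \<in> p ` (Q V \<inter> U V)"
        using yF(2)[OF V NF(2)] Q V by (metis IntI imageI)
      then show "s \<in> K V" using s \<delta> by (simp add: K_def)
    qed
    have "openin S N'"
      unfolding N'_def
      by (rule openin_Inter)
        (use NF K(1) openin_continuous_map_preimage[OF \<pi> M(1)] in auto)
    moreover have "s \<in> N'" using NF(2) K(2) s M(2) by (auto simp: N'_def)
    moreover have "f s' \<in> tube W r" if s': "s' \<in> N'" for s'
    proof -
      have s'N: "s' \<in> N" and s'S: "s' \<in> topspace S" and s'M: "\<pi> s' \<in> M"
        using s' N by (auto simp: N'_def)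
      interpret B: banach_space_on "fiber E p (\<pi> s')" add smul "zero (\<pi> s')" nrm
        by (rule fiber_banach[OF base[OF s'S]])
      have "\<exists>z. z \<in> Q V \<inter> U V \<and> p z = \<pi> s'" if "V \<in> F" for V
      proof -
        have "\<pi> s' \<in> p ` (Q V \<inter> U V)" using s' that by (simp add: N'_def K_def)
        then show ?thesis by (metis imageE)
      qed
      then obtain z where z: "\<And>V. V \<in> F \<Longrightarrow> z V \<in> Q V \<inter> U V" "\<And>V. V \<in> F \<Longrightarrow> p (z V) = \<pi> s'"
        by metis
      have zf: "z V \<in> fiber E p (\<pi> s')" if "V \<in> F" for V
        using z[OF that] openin_subset[of E "Q V"] Q that by (auto simp: in_fiber)
      have "\<bar>\<phi> V s' - \<phi> V s\<bar> < \<delta>" if "V \<in> F" for V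
        using s' that by (auto simp: N'_def K_def dist_real_def)
      then have zW: "fcomb (\<pi> s') (\<lambda>V. \<phi> V s') z F \<in> W"
        using z zf by (intro QW[rule_format, OF s'M]) auto
      have "fdist (f s') (fcomb (\<pi> s') (\<lambda>V. \<phi> V s') z F) \<le>
          (\<Sum>V\<in>F. \<bar>\<phi> V s'\<bar> * fdist (y V s') (z V))"
        unfolding eq[OF s'N] by (rule B.d_comb_le[OF NF(3)]) (auto intro: yF(1)[OF _ s'N] zf)
      also have "\<dots> \<le> (\<Sum>V\<in>F. \<phi> V s' * (r/2))"
      proof (rule sum_mono)
        fix V assume V: "V \<in> F"
        have "p (y V s') = p (z V)" using yF(1)[OF V s'N] z(2)[OF V] by (simp add: in_fiber)
        then have "fdist (y V s') (z V) \<le> r/2"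
          using U(1)[of V] V NF(4) yF(2)[OF V s'N] z(1)[OF V] unfolding thin_def by fastforce
        moreover have "0 \<le> \<phi> V s'" using \<phi>_nonneg V NF(4) s'S by blast
        ultimately show "\<bar>\<phi> V s'\<bar> * fdist (y V s') (z V) \<le> \<phi> V s' * (r/2)"
          using mult_left_mono[of "fdist (y V s') (z V)" "r/2" "\<phi> V s'"] by simp
      qed
      also have "\<dots> = r/2" using NF(6) s'N by (simp only: sum_distrib_right[symmetric] mult_1 simp_thms)
      finally have "fdist (f s') (fcomb (\<pi> s') (\<lambda>V. \<phi> V s') z F) < r" using r by simp
      moreover have "f s' \<in> fiber E p (\<pi> s')" using sel fib s'S by blast
      moreover have "fcomb (\<pi> s') (\<lambda>V. \<phi> V s') z F \<in> fiber E p (\<pi> s')"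
        by (rule B.comb_closed) (rule zf)
      ultimately show ?thesis using zW by (auto simp: tube_def in_fiber)
    qed
    ultimately show ?thesis by blast
  qed
  then show ?thesis using sel unfolding approx_continuous_def by blast
qed

text \<open>Intersecting \<open>\<Phi> s\<close> with balls around an approximately continuous selection \<open>f\<close> destroys lower
  semicontinuity, but the values \<open>f s\<close> remain limits of points of nearby sets, and this is all that
  \<open>approx_continuous_selection\<close> asks for.\<close>

lemma approx_continuous_selection_step:
  assumes S: "paracompact_space S" and \<pi>: "continuous_map S T \<pi>"
    and fib: "\<And>s. s \<in> topspace S \<Longrightarrow> \<Phi> s \<subseteq> fiber E p (\<pi> s)"
    and conv: "\<And>s. s \<in> topspace S \<Longrightarrow> bundle_convex add smul (\<Phi> s)"
    and lsc: "lower_semicontinuous_map S E \<Phi>"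
    and f: "approx_continuous S f r" "\<And>s. s \<in> topspace S \<Longrightarrow> f s \<in> \<Phi> s"
    and r: "0 < r" "0 < r'"
  shows "\<exists>g. approx_continuous S g r' \<and> (\<forall>s\<in>topspace S. g s \<in> \<Phi> s \<and> fdist (g s) (f s) < 2 * r)"
proof -
  have base: "\<pi> s \<in> topspace T" if "s \<in> topspace S" for s
    using \<pi> that by (auto simp: continuous_map_def)
  have ff: "f s \<in> fiber E p (\<pi> s)" if "s \<in> topspace S" for s
    using f(2) fib that by blast
  \<comment> \<open>The radius \<open>2 * r\<close> has two sources: \<open>f s'\<close> is within
    \<open>r\<close> of some \<open>y\<close> in \<open>U\<close> by approximate continuity, and
    \<open>y\<close> is within \<open>r\<close> of any point of \<open>U\<close> in its fibre by
    thinness.\<close>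
  define \<Psi> where "\<Psi> s = \<Phi> s \<inter> {x \<in> fiber E p (\<pi> s). fdist x (f s) < 2 * r}" for s
  have "\<exists>g. approx_continuous S g r' \<and> (\<forall>s\<in>topspace S. g s \<in> \<Psi> s)"
  proof (rule approx_continuous_selection[OF S \<pi>])
    fix s assume s: "s \<in> topspace S"
    interpret B: banach_space_on "fiber E p (\<pi> s)" add smul "zero (\<pi> s)" nrm
      by (rule fiber_banach[OF base[OF s]])
    show "\<Psi> s \<subseteq> fiber E p (\<pi> s)" by (auto simp: \<Psi>_def)
    show "bundle_convex add smul (\<Psi> s)"
      unfolding \<Psi>_def using conv[OF s] ff[OF s]
      by (intro B.bundle_convex_Int B.bundle_convex_ball)
    show "\<exists>x\<in>fiber E p (\<pi> s). \<forall>W. openin E W \<and> x \<in> W \<longrightarrow>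
        (\<exists>N. openin S N \<and> s \<in> N \<and> (\<forall>s'\<in>N. \<Psi> s' \<inter> W \<noteq> {}))"
    proof (rule bexI[OF _ ff[OF s]], intro allI impI, elim conjE)
      fix W assume W: "openin E W" "f s \<in> W"
      have "f s \<in> topspace E" using ff[OF s] by (simp add: in_fiber)
      from thin_nhd[OF this r(1)]
      obtain U where U: "openin E U" "f s \<in> U" "\<forall>y\<in>U. \<forall>z\<in>U. p y = p z \<longrightarrow> fdist y z < r"
        by (elim exE conjE)
      obtain N where N: "openin S N" "s \<in> N" "f ` N \<subseteq> tube U r"
        by (rule approx_continuousE[OF f(1) s U(1,2)])
      let ?N = "N \<inter> {s' \<in> topspace S. (U \<inter> W) \<inter> \<Phi> s' \<noteq> {}}"
      have UW: "openin E (U \<inter> W)" "U \<inter> W \<noteq> {}" using U W by auto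
      have "openin S ?N"
        using lsc UW N(1) unfolding lower_semicontinuous_map_def by blast
      moreover have "s \<in> ?N" using N(2) s U(2) W(2) f(2)[OF s] by blast
      moreover have "\<Psi> s' \<inter> W \<noteq> {}" if s': "s' \<in> ?N" for s'
      proof -
        obtain x where x: "x \<in> U" "x \<in> W" "x \<in> \<Phi> s'" and s'S: "s' \<in> topspace S"
          using s' by blast
        interpret B': banach_space_on "fiber E p (\<pi> s')" add smul "zero (\<pi> s')" nrm
          by (rule fiber_banach[OF base[OF s'S]])
        have xf: "x \<in> fiber E p (\<pi> s')" using x fib s'S by blast
        obtain y where y: "y \<in> U" "p y = p (f s')" "fdist (f s') y < r"
          using N(3) s' by (auto simp: tube_def)
        have yf: "y \<in> fiber E p (\<pi> s')"
          using y ff[OF s'S] openin_subset[OF U(1)] by (auto simp: in_fiber)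
        have "fdist x y < r" using U(3) x y(1) xf yf by (simp add: in_fiber)
        moreover have "fdist x (f s') \<le> fdist x y + fdist y (f s')"
          by (rule B'.d_triangle[OF xf yf ff[OF s'S]])
        ultimately have "fdist x (f s') < 2 * r"
          using y(3) B'.d_commute[OF ff[OF s'S] yf] by simp
        then show ?thesis using x xf by (auto simp: \<Psi>_def)
      qed
      ultimately show "\<exists>N. openin S N \<and> s \<in> N \<and> (\<forall>s'\<in>N. \<Psi> s' \<inter> W \<noteq> {})" by blast
    qed
  qed (rule r)
  then show ?thesis by (auto simp: \<Psi>_def)
qed

section \<open>Fibrewise limits and exact selections\<close>

lemma fiber_geometric_limit:
  assumes t: "t \<in> topspace T" and u: "\<And>n. u n \<in> fiber E p t"
    and step: "\<And>n. fdist (u (Suc n)) (u n) < 2 * (1/2)^n"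
  shows "\<exists>l\<in>fiber E p t. (\<lambda>n. fdist (u n) l) \<longlonglongrightarrow> 0 \<and> (\<forall>n. fdist (u n) l \<le> 4 * (1/2)^n)"
proof -
  interpret B: banach_space_on "fiber E p t" add smul "zero t" nrm
    by (rule fiber_banach[OF t])
  \<comment> \<open>The exact partial sum of the geometric series is kept as the bound, because the
    weaker bound \<open>4 * (1/2)^n\<close> would not pass through the induction.\<close>
  have tail: "fdist (u n) (u (n + k)) \<le> 4 * (1/2)^n - 4 * (1/2)^(n + k)" for n k
  proof (induction k)
    case 0
    then show ?case by (simp add: B.d_refl u)
  next
    case (Suc k)
    have "fdist (u n) (u (n + Suc k)) \<le> fdist (u n) (u (n + k)) + fdist (u (n + k)) (u (Suc (n + k)))"
      using B.d_triangle[OF u[of n] u[of "n + k"] u[of "n + Suc k"]] by simp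
    also have "fdist (u (n + k)) (u (Suc (n + k))) \<le> 2 * (1/2)^(n + k)"
      using step[of "n + k"] B.d_commute[OF u[of "n + k"] u[of "Suc (n + k)"]] by simp
    finally show ?case using Suc by simp
  qed
  have tail': "fdist (u n) (u m) \<le> 4 * (1/2)^n" if "n \<le> m" for n m
  proof -
    have "fdist (u n) (u m) \<le> 4 * (1/2)^n - 4 * (1/2)^m"
      using tail[of n "m - n"] that by simp
    moreover have "(0::real) \<le> 4 * (1/2)^m" by simp
    ultimately show ?thesis by linarith
  qed
  \<comment> \<open>The factor \<open>8\<close> comes from comparing both indices with
    \<open>N\<close>, each at a cost of at most \<open>4 * (1/2)^N\<close>.\<close>
  have lim: "(\<lambda>n. 8 * (1/2)^n) \<longlonglongrightarrow> (0::real)"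
    by (intro tendsto_mult_right_zero LIMSEQ_power_zero) simp
  have "\<exists>l\<in>fiber E p t. (\<lambda>n. nrm (add (u n) (smul (-1) l))) \<longlonglongrightarrow> 0"
  proof (rule B.complete[OF u])
    fix e :: real assume "0 < e"
    then have "\<forall>\<^sub>F n in sequentially. 8 * (1/2)^n < e"
      using lim by (rule order_tendstoD(2)[rotated])
    then obtain N where N: "8 * (1/2)^N < e"
      unfolding eventually_sequentially by blast
    have "fdist (u m) (u n) < e" if "m \<ge> N" "n \<ge> N" for m n
      using B.d_triangle[OF u[of m] u[of N] u[of n]] B.d_commute[OF u[of m] u[of N]]
        tail'[OF that(1)] tail'[OF that(2)] N by linarith
    then show "\<exists>N. \<forall>m\<ge>N. \<forall>n\<ge>N. nrm (add (u m) (smul (- 1) (u n))) < e"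
      unfolding bundle_dist_def by blast
  qed
  then obtain l where l: "l \<in> fiber E p t" "(\<lambda>n. fdist (u n) l) \<longlonglongrightarrow> 0"
    unfolding bundle_dist_def by blast
  \<comment> \<open>The tail bound survives letting \<open>m\<close> grow in the triangle inequality
    through \<open>u m\<close>.\<close>
  have "fdist (u n) l \<le> 4 * (1/2)^n" for n
  proof (rule LIMSEQ_le_const)
    show "(\<lambda>m. 4 * (1/2)^n + fdist (u m) l) \<longlonglongrightarrow> 4 * (1/2)^n"
      using tendsto_add[OF tendsto_const l(2)] by simp
    show "\<exists>N. \<forall>m\<ge>N. fdist (u n) l \<le> 4 * (1/2)^n + fdist (u m) l"
    proof (intro exI[of _ n] allI impI)
      fix m assume "n \<le> m"
      then show "fdist (u n) l \<le> 4 * (1/2)^n + fdist (u m) l"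
        using B.d_triangle[OF u[of n] u[of m] l(1)] tail'[of n m] by linarith
    qed
  qed
  then show ?thesis using l by blast
qed

text \<open>If \<open>l\<close> were outside \<open>C\<close>, a whole tube around it would avoid
  \<open>C\<close> by \<open>small_tube\<close>, yet that tube contains \<open>u n\<close> as soon
  as \<open>u n\<close> is close to \<open>l\<close> in the fibre.\<close>

lemma closedin_imp_norm_closed:
  assumes C: "closedin E C" and l: "l \<in> topspace E"
    and u: "\<And>n. u n \<in> C" "\<And>n. p (u n) = p l" "(\<lambda>n. fdist (u n) l) \<longlonglongrightarrow> 0"
  shows "l \<in> C"
proof (rule ccontr)
  assume "l \<notin> C"
  then have "openin E (topspace E - C)" "l \<in> topspace E - C" using C l by auto
  from small_tube[OF this]
  obtain W \<delta> where W: "l \<in> W" "0 < \<delta>" "tube W \<delta> \<subseteq> topspace E - C"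
    by (elim exE conjE)
  have "\<forall>\<^sub>F n in sequentially. fdist (u n) l < \<delta>"
    using order_tendstoD(2)[OF u(3) W(2)] .
  then obtain n where n: "fdist (u n) l < \<delta>"
    unfolding eventually_sequentially by blast
  have "u n \<in> topspace E" using u(1) C closedin_subset by blast
  then have "u n \<in> tube W \<delta>"
    using n W(1) u(2) by (auto simp: tube_def intro!: bexI[of _ l])
  then show False using W(3) u(1)[of n] by blast
qed

text \<open>Closedness is phrased through norm-convergent sequences in a fibre. This is the form in
  which the limit of the approximations uses it, and for a singleton it reduces to uniqueness of
  limits of real sequences.\<close>

lemma continuous_selection:
  assumes S: "paracompact_space S" and \<pi>: "continuous_map S T \<pi>"
    and fib: "\<And>s. s \<in> topspace S \<Longrightarrow> \<Phi> s \<subseteq> fiber E p (\<pi> s)"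
    and conv: "\<And>s. s \<in> topspace S \<Longrightarrow> bundle_convex add smul (\<Phi> s)"
    and lsc: "lower_semicontinuous_map S E \<Phi>"
    and ne: "\<And>s. s \<in> topspace S \<Longrightarrow> \<Phi> s \<noteq> {}"
    and norm_closed: "\<And>s u l. s \<in> topspace S \<Longrightarrow> (\<And>n. u n \<in> \<Phi> s) \<Longrightarrow> l \<in> fiber E p (\<pi> s) \<Longrightarrow>
      (\<lambda>n. fdist (u n) l) \<longlonglongrightarrow> 0 \<Longrightarrow> l \<in> \<Phi> s"
  shows "\<exists>f. continuous_map S E f \<and> (\<forall>s\<in>topspace S. f s \<in> \<Phi> s)"
proof -
  have base: "\<pi> s \<in> topspace T" if "s \<in> topspace S" for s
    using \<pi> that by (auto simp: continuous_map_def)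
  \<comment> \<open>Radius \<open>1\<close> is \<open>(1/2)^0\<close>, the start of the recursion.
    Each refinement moves the selection by less than twice the previous radius.\<close>
  have "\<exists>f. approx_continuous S f 1 \<and> (\<forall>s\<in>topspace S. f s \<in> \<Phi> s)"
  proof (rule approx_continuous_selection[OF S \<pi> fib conv])
    fix s assume s: "s \<in> topspace S"
    obtain x where x: "x \<in> \<Phi> s" using ne[OF s] by blast
    have "\<exists>N. openin S N \<and> s \<in> N \<and> (\<forall>s'\<in>N. \<Phi> s' \<inter> W \<noteq> {})" if "openin E W" "x \<in> W" for W
      using lsc that x s unfolding lower_semicontinuous_map_def
      by (intro exI[of _ "{s' \<in> topspace S. W \<inter> \<Phi> s' \<noteq> {}}"]) blast
    then show "\<exists>x\<in>fiber E p (\<pi> s). \<forall>W. openin E W \<and> x \<in> W \<longrightarrow>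
        (\<exists>N. openin S N \<and> s \<in> N \<and> (\<forall>s'\<in>N. \<Phi> s' \<inter> W \<noteq> {}))"
      using x fib[OF s] by blast
  qed simp_all
  then have "\<exists>f. \<forall>n. (approx_continuous S (f n) ((1/2)^n) \<and> (\<forall>s\<in>topspace S. f n s \<in> \<Phi> s)) \<and>
      (\<forall>s\<in>topspace S. fdist (f (Suc n) s) (f n s) < 2 * (1/2)^n)"
  proof (intro dependent_nat_choice)
    fix f and n :: nat
    assume f: "approx_continuous S f ((1/2)^n) \<and> (\<forall>s\<in>topspace S. f s \<in> \<Phi> s)"
    have "\<exists>g. approx_continuous S g ((1/2)^Suc n) \<and>
        (\<forall>s\<in>topspace S. g s \<in> \<Phi> s \<and> fdist (g s) (f s) < 2 * (1/2)^n)"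
      by (rule approx_continuous_selection_step[OF S \<pi> fib conv lsc]) (use f in auto)
    then show "\<exists>g. (approx_continuous S g ((1/2)^Suc n) \<and> (\<forall>s\<in>topspace S. g s \<in> \<Phi> s)) \<and>
        (\<forall>s\<in>topspace S. fdist (g s) (f s) < 2 * (1/2)^n)"
      by blast
  qed simp
  then obtain f where f: "\<And>n. approx_continuous S (f n) ((1/2)^n)"
    "\<And>n s. s\<in>topspace S \<Longrightarrow> f n s \<in> \<Phi> s"
    "\<And>n s. s\<in>topspace S \<Longrightarrow> fdist (f (Suc n) s) (f n s) < 2 * (1/2)^n"
    by blast
  have ff: "f n s \<in> fiber E p (\<pi> s)" if "s \<in> topspace S" for n s
    using f(2) fib that by blast
  have "\<exists>l\<in>fiber E p (\<pi> s). (\<lambda>n. fdist (f n s) l) \<longlonglongrightarrow> 0 \<and> (\<forall>n. fdist (f n s) l \<le> 4 * (1/2)^n)"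
    if s: "s \<in> topspace S" for s
    by (rule fiber_geometric_limit[OF base[OF s] ff[OF s] f(3)[OF s]])
  then have "\<forall>s\<in>topspace S. \<exists>l. l \<in> fiber E p (\<pi> s) \<and> (\<lambda>n. fdist (f n s) l) \<longlonglongrightarrow> 0 \<and>
      (\<forall>n. fdist (f n s) l \<le> 4 * (1/2)^n)"
    by blast
  from bchoice[OF this]
  obtain g where g: "\<And>s. s \<in> topspace S \<Longrightarrow> g s \<in> fiber E p (\<pi> s)"
    "\<And>s. s \<in> topspace S \<Longrightarrow> (\<lambda>n. fdist (f n s) (g s)) \<longlonglongrightarrow> 0"
    "\<And>s n. s \<in> topspace S \<Longrightarrow> fdist (f n s) (g s) \<le> 4 * (1/2)^n"
    by blast
  have "continuous_map S E g"
  proof (rule continuous_map_uniform_limit)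
    show "g s \<in> topspace E" if "s \<in> topspace S" for s using g(1)[OF that] by (simp add: in_fiber)
    fix r :: real assume "0 < r"
    moreover have "(\<lambda>n. 4 * (1/2)^n) \<longlonglongrightarrow> (0::real)"
      by (intro tendsto_mult_right_zero LIMSEQ_power_zero) simp
    ultimately have "\<forall>\<^sub>F n in sequentially. 4 * (1/2)^n < r"
      by (intro order_tendstoD(2))
    \<comment> \<open>One index serves twice: \<open>4 * (1/2)^n < r\<close> bounds the distance to
      the limit and also the jump size \<open>(1/2)^n\<close>.\<close>
    then obtain n where n: "4 * (1/2)^n < r"
      unfolding eventually_sequentially by blast
    moreover have "(0::real) \<le> (1/2)^n" by simp
    ultimately have "(1/2)^n \<le> r" by linarith
    then have "approx_continuous S (f n) r"
      by (rule approx_continuous_mono[OF f(1)])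
    moreover have "fdist (f n s) (g s) < r" if "s \<in> topspace S" for s
      using g(3)[OF that, of n] n by linarith
    ultimately show "\<exists>h. approx_continuous S h r \<and>
        (\<forall>s\<in>topspace S. h s \<in> topspace E \<and> p (h s) = p (g s) \<and> fdist (h s) (g s) < r)"
      using ff g(1) by (intro exI[of _ "f n"]) (simp add: in_fiber)
  qed
  moreover have "g s \<in> \<Phi> s" if s: "s \<in> topspace S" for s
    by (rule norm_closed[OF s f(2)[OF s] g(1)[OF s] g(2)[OF s]])
  ultimately show ?thesis by blast
qed

end

text \<open>If \<open>y\<close> lies in \<open>U\<close>, the set in question is unchanged, since
  \<open>\<Phi> a\<close> already met \<open>U\<close> in \<open>y\<close>. Otherwise it loses at
  most the point \<open>a\<close>, which is closed in a T1 space.\<close>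

lemma lower_semicontinuous_map_fix_value:
  assumes "t1_space X" "lower_semicontinuous_map X Y \<Phi>" "y \<in> \<Phi> a"
  shows "lower_semicontinuous_map X Y (\<Phi>(a := {y}))"
  unfolding lower_semicontinuous_map_def
proof (intro allI impI, elim conjE)
  fix U assume U: "openin Y U" "U \<noteq> {}"
  have op: "openin X {t \<in> topspace X. U \<inter> \<Phi> t \<noteq> {}}"
    using assms(2) U unfolding lower_semicontinuous_map_def by blast
  show "openin X {t \<in> topspace X. U \<inter> (\<Phi>(a := {y})) t \<noteq> {}}"
  proof (cases "y \<in> U")
    case True
    then have "{t \<in> topspace X. U \<inter> (\<Phi>(a := {y})) t \<noteq> {}} = {t \<in> topspace X. U \<inter> \<Phi> t \<noteq> {}}"
      using assms(3) by auto
    then show ?thesis using op by simp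
  next
    case False
    then have "{t \<in> topspace X. U \<inter> (\<Phi>(a := {y})) t \<noteq> {}} = {t \<in> topspace X. U \<inter> \<Phi> t \<noteq> {}} - {a}"
      by auto
    then show ?thesis using op assms(1) t1_space_openin_delete_alt[of X] by simp
  qed
qed

theorem theorem2p9:
  fixes E :: "'e topology" and p :: "'e \<Rightarrow> 't" and T :: "'t topology"
    and add :: "'e \<Rightarrow> 'e \<Rightarrow> 'e" and smul :: "'k::real_normed_field \<Rightarrow> 'e \<Rightarrow> 'e"
    and zero :: "'t \<Rightarrow> 'e" and nrm :: "'e \<Rightarrow> real"
    and S :: "'s topology" and \<pi> :: "'s \<Rightarrow> 't" and \<Phi> :: "'s \<Rightarrow> 'e set"
  assumes "banach_bundle E p T add smul zero nrm"
    and "paracompact_space S"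
    and "continuous_map S T \<pi>" and "open_map S T \<pi>" and "\<pi> ` topspace S = topspace T"
    and "lower_semicontinuous_map S E \<Phi>"
    and "\<And>s. s \<in> topspace S \<Longrightarrow> \<Phi> s \<noteq> {} \<and> closedin E (\<Phi> s)"
    and "\<And>s. s \<in> topspace S \<Longrightarrow> \<Phi> s \<subseteq> fiber E p (\<pi> s) \<and> bundle_convex add smul (\<Phi> s)"
  shows "(\<exists>f. continuous_map S E f \<and> (\<forall>s\<in>topspace S. p (f s) = \<pi> s \<and> f s \<in> \<Phi> s)) \<and>
    (\<forall>s\<^sub>0\<in>topspace S. \<forall>x\<^sub>0\<in>\<Phi> s\<^sub>0.
      \<exists>f. continuous_map S E f \<and> (\<forall>s\<in>topspace S. p (f s) = \<pi> s \<and> f s \<in> \<Phi> s) \<and> f s\<^sub>0 = x\<^sub>0)"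
proof -
  interpret banach_bundle E p T add smul zero nrm by fact
  have proj: "p x = \<pi> s" if "s \<in> topspace S" "x \<in> \<Phi> s" for s x
    using assms(8)[OF that(1)] that(2) by (auto simp: in_fiber)
  have norm_closed: "l \<in> \<Phi> s" if "s \<in> topspace S" "\<And>n. u n \<in> \<Phi> s" "l \<in> fiber E p (\<pi> s)"
      "(\<lambda>n. fdist (u n) l) \<longlonglongrightarrow> 0" for s u l
    using closedin_imp_norm_closed[of "\<Phi> s" l u] assms(7)[OF that(1)] that proj[OF that(1)]
    by (simp add: in_fiber)
  show ?thesis
  proof (intro conjI ballI)
    have "\<exists>f. continuous_map S E f \<and> (\<forall>s\<in>topspace S. f s \<in> \<Phi> s)"
      by (rule continuous_selection[OF assms(2,3) _ _ assms(6) _ norm_closed]) (use assms(7,8) in auto)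
    then show "\<exists>f. continuous_map S E f \<and> (\<forall>s\<in>topspace S. p (f s) = \<pi> s \<and> f s \<in> \<Phi> s)"
      using proj by blast
  next
    fix s0 x0 assume s0: "s0 \<in> topspace S" and x0: "x0 \<in> \<Phi> s0"
    interpret B: banach_space_on "fiber E p (\<pi> s0)" add smul "zero (\<pi> s0)" nrm
      using assms(3) s0 by (intro fiber_banach) (auto simp: continuous_map_def)
    have x0f: "x0 \<in> fiber E p (\<pi> s0)" using assms(8) s0 x0 by blast
    have "\<exists>f. continuous_map S E f \<and> (\<forall>s\<in>topspace S. f s \<in> (\<Phi>(s0 := {x0})) s)"
    proof (rule continuous_selection[OF assms(2,3)])
      show "lower_semicontinuous_map S E (\<Phi>(s0 := {x0}))"
        using assms(2,6) x0 unfolding paracompact_space_def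
        by (intro lower_semicontinuous_map_fix_value Hausdorff_imp_t1_space) auto
      show "l \<in> (\<Phi>(s0 := {x0})) s" if s: "s \<in> topspace S" and u: "\<And>n. u n \<in> (\<Phi>(s0 := {x0})) s"
          and l: "l \<in> fiber E p (\<pi> s)" "(\<lambda>n. fdist (u n) l) \<longlonglongrightarrow> 0" for s u l
      proof (cases "s = s0")
        case True
        \<comment> \<open>At \<open>s0\<close> the sequence is constantly \<open>x0\<close>, so
          convergence to \<open>l\<close> forces the constant distance to be
          \<open>0\<close>.\<close>
        then have "(\<lambda>n. fdist x0 l) \<longlonglongrightarrow> 0" using u l(2) by simp
        then have "fdist x0 l = 0" using LIMSEQ_unique tendsto_const by blast
        then show ?thesis using B.d_eq_0[OF x0f, of l] l(1) True by simp
      next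
        case False
        then show ?thesis using norm_closed[OF s _ l] u by simp
      qed
    qed (use assms(7,8) x0f B.bundle_convex_singleton in auto)
    then obtain f where f: "continuous_map S E f" "\<forall>s\<in>topspace S. f s \<in> (\<Phi>(s0 := {x0})) s"
      by blast
    have "f s0 = x0" using f(2) s0 by fastforce
    moreover have "f s \<in> \<Phi> s" if "s \<in> topspace S" for s
      using f(2) that x0 by (cases "s = s0") auto
    ultimately show "\<exists>f. continuous_map S E f \<and> (\<forall>s\<in>topspace S. p (f s) = \<pi> s \<and> f s \<in> \<Phi> s) \<and> f s0 = x0"
      using f(1) proj by blast
  qed
qed

end
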